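(* Let $p\geq1$ and $r\geq 1$. There exists a function $\mathscr E_{r,p}^n:[1,\infty)^2\to(0,\infty)$ that increases in each variable and depends only on $r$, $p$ and the dimension $n$, such that the following holds: for all weights $u$ and $v$ on $\mathbb R^n$ with $u\in A_p^{\mathcal R}$ and $uv^p\in A_r^{\mathcal R}$, and every measurable function $f$ on $\mathbb R^n$, $$\left\Vert \frac{Mf}{v}\right\Vert_{L^{p,\infty}(uv^p)} \leq \mathscr E_{r,p}^n\big([u]_{A_p^{\mathcal R}},[uv^p]_{A_r^{\mathcal R}}\big)\, \Vert f\Vert_{L^{p,1}(u)}.$$
   Context: A weight is a positive, locally integrable function on $\mathbb R^n$. Cubes have sides parallel to the axes. For a weight $w$ and a measurable set $E$, $w(E)=\int_E w(x)\,dx$, and $\frac1p+\frac1{p'}=1$. The Hardy-Littlewood maximal operator is $Mf(x)=\sup_{Q\ni x}\frac1{|Q|}\int_Q|f|$, the supremum being over all cubes $Q$ containing $x$. For a weight $w$ (identified with the measure $w(x)\,dx$), put $\lambda_f^w(y)=w(\{x:|f(x)|>y\})$. For $p>0$: $\Vert f\Vert_{L^{p,1}(w)}=p\int_0^\infty \lambda_f^w(y)^{1/p}\,dy$ and $\Vert f\Vert_{L^{p,\infty}(w)}=\sup_{y>0} y\,\lambda_f^w(y)^{1/p}$; $L^{\infty,\infty}(w)$ means $L^\infty(w)$. For $1\le p<\infty$, $w\in A_p^{\mathcal R}$ means $[w]_{A_p^{\mathcal R}}=\sup_Q w(Q)^{1/p}\,\frac{\Vert \chi_Q w^{-1}\Vert_{L^{p',\infty}(w)}}{|Q|}<\infty$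 (supremum over all cubes), so $A_1^{\mathcal R}=A_1$. *)

theory Defs
  imports "HOL-Analysis.Analysis" "HOL-Probability.Essential_Supremum"
begin

text \<open>
  Everywhere below, a measurable function \<open>f\<close> enters only through \<open>\<bar>f\<bar>\<close>, so the norms and the
  maximal operator act on functions with values in \<open>[0, \<infinity>]\<close>.
\<close>

definition cubes :: "(real ^ 'n) set set" where
  "cubes = {cbox a (a + (\<chi> i. h)) | a h. 0 < h}"

definition weight :: "(real ^ 'n \<Rightarrow> real) \<Rightarrow> bool" where
  "weight w \<longleftrightarrow> (\<forall>x. 0 < w x) \<and> (\<forall>K. compact K \<longrightarrow> set_integrable lebesgue K w)"

definition weight_measure :: "(real ^ 'n \<Rightarrow> real) \<Rightarrow> (real ^ 'n) measure" where
  "weight_measure w = density lebesgue (\<lambda>x. ennreal (w x))"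

text \<open>\<open>t powr a\<close> for \<open>t \<in> [0, \<infinity>]\<close>; it is only used for \<open>a > 0\<close>, where \<open>\<infinity> powr a = \<infinity>\<close>.\<close>

definition ennreal_powr :: "ennreal \<Rightarrow> real \<Rightarrow> ennreal" where
  "ennreal_powr t a = (if t = \<infinity> then \<infinity> else ennreal (enn2real t powr a))"

definition distribution_fun ::
    "(real ^ 'n \<Rightarrow> real) \<Rightarrow> (real ^ 'n \<Rightarrow> ennreal) \<Rightarrow> real \<Rightarrow> ennreal" where
  "distribution_fun w g y = emeasure (weight_measure w) {x. g x > ennreal y}"

definition lorentz_1_norm ::
    "real \<Rightarrow> (real ^ 'n \<Rightarrow> real) \<Rightarrow> (real ^ 'n \<Rightarrow> ennreal) \<Rightarrow> ennreal" where
  "lorentz_1_norm p w g =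
     ennreal p * (\<integral>\<^sup>+ y\<in>{0<..}. ennreal_powr (distribution_fun w g y) (1 / p) \<partial>lborel)"

text \<open>The exponent ranges over \<open>(0, \<infinity>]\<close>; the space for the exponent \<open>\<infinity>\<close> is \<open>L\<^sup>\<infinity>(w)\<close>.\<close>

definition lorentz_weak_norm ::
    "ereal \<Rightarrow> (real ^ 'n \<Rightarrow> real) \<Rightarrow> (real ^ 'n \<Rightarrow> ennreal) \<Rightarrow> ennreal" where
  "lorentz_weak_norm q w g =
     (if q = \<infinity> then esssup (weight_measure w) g
      else (SUP y\<in>{0<..}. ennreal y * ennreal_powr (distribution_fun w g y) (1 / real_of_ereal q)))"

definition conj_exponent :: "real \<Rightarrow> ereal" where
  "conj_exponent p = (if p = 1 then \<infinity> else ereal (p / (p - 1)))"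

definition ApR_const :: "real \<Rightarrow> (real ^ 'n \<Rightarrow> real) \<Rightarrow> ennreal" where
  "ApR_const p w =
     (SUP Q\<in>cubes. ennreal_powr (emeasure (weight_measure w) Q) (1 / p)
        * lorentz_weak_norm (conj_exponent p) w (\<lambda>x. indicator Q x * ennreal (inverse (w x)))
        / emeasure lebesgue Q)"

definition ApR :: "real \<Rightarrow> (real ^ 'n \<Rightarrow> real) set" where
  "ApR p = {w. weight w \<and> ApR_const p w < \<infinity>}"

definition maximal_op :: "(real ^ 'n \<Rightarrow> ennreal) \<Rightarrow> real ^ 'n \<Rightarrow> ennreal" where
  "maximal_op g x =
     (SUP Q\<in>{Q\<in>cubes. x \<in> Q}. (\<integral>\<^sup>+ z\<in>Q. g z \<partial>lebesgue) / emeasure lebesgue Q)"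

end

theory Submission
  imports Defs
begin

text \<open>
  Write \<open>w = u v\<^sup>p\<close> and, for a fixed level, absorb the level into \<open>v\<close>; then \<open>w {Mf > v}\<close> has to be
  bounded by a multiple of the \<open>p\<close>-th power of the Lorentz norm of \<open>f\<close>. Testing the \<open>A\<^sub>q\<^sup>R\<close> condition
  on characteristic functions gives \<open>|S| / |Q| \<le> C (w(S) / w(Q))\<^bsup>1/q\<^esup>\<close> for \<open>S \<subseteq> Q\<close>
  (\<open>ApR_imp_restricted_Ap\<close>). Everything follows from this inequality for the two weights. It has
  three consequences: the weights are doubling; \<open>w(S)\<close> decays like a power of \<open>|S| / |Q|\<close>
  (\<open>weight_decay\<close>); and, integrating over the layers of \<open>f\<close>, the average \<open>m\<^sub>Q\<close> of \<open>|f|\<close> over \<open>Q\<close>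
  satisfies \<open>m\<^sub>Q\<^sup>p u(Q) \<le> C A(Q)\<close>, where \<open>A(Q)\<close> is the \<open>p\<close>-th power of the Lorentz norm of \<open>f\<close> on \<open>Q\<close>
  (\<open>avg_powr_le_level_root\<close>). The quantity \<open>A\<close> is superadditive over disjoint cubes
  (\<open>sum_level_root_integral_le\<close>).

  For every integer \<open>k\<close> take the maximal dyadic cubes on which the average of \<open>|f|\<close> exceeds the \<open>k\<close>-th
  power of \<open>2\<^bsup>n+1\<^esup>\<close>. Every point with \<open>Mf > v\<close> lies in the exceptional part
  \<open>T\<^sub>Q = {x \<in> 3Q. v x \<le> C m\<^sub>Q}\<close> of such a cube (\<open>superlevel_set_subset\<close>), and
  \<open>w(T\<^sub>Q) \<le> C m\<^sub>Q\<^sup>p u(T\<^sub>Q)\<close>. The danger is that the cubes are nested over all levels. They are sparse,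
  however, so by the inequality for \<open>w\<close> the \<open>w\<close>-weights of a nested family add up to at most a
  multiple of the weight of its maximal cubes (\<open>carleson_packing\<close>).

  Sort the cubes by \<open>\<rho> = m\<^sub>Q\<^sup>p u(Q) / w(Q)\<close>. If \<open>\<rho>\<close> is bounded below, then \<open>w(3Q)\<close> itself is
  controlled by \<open>A(Q)\<close>, and the maximal cubes of this kind suffice (\<open>W_heavy\<close>). If \<open>\<rho>\<close> is of size
  \<open>b\<^sup>-\<^sup>m\<close>, then \<open>w(T\<^sub>Q) \<le> C \<rho> w(Q)\<close> is small compared with \<open>w(Q)\<close>, so \<open>T\<^sub>Q\<close> has small volume by the
  inequality for \<open>w\<close>, and small \<open>u\<close>-weight by the decay of \<open>u\<close>; this gains a factor \<open>\<theta>\<^sup>m\<close> with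
  \<open>\<theta> < 1\<close> (\<open>U_exceptional_decay\<close>). Within one size of \<open>\<rho>\<close> the packing estimate reduces the sum
  to maximal cubes, where \<open>w(Q)\<close> is comparable to \<open>m\<^sub>Q\<^sup>p u(Q) / \<rho>\<close> and hence controlled by \<open>A(Q)\<close>
  (\<open>W_light_level\<close>). The geometric series in \<open>m\<close> finishes the estimate (\<open>superlevel_set_bound\<close>), with
  a constant that is polynomial in the constants of the two weights.
\<close>

section \<open>Half-open dyadic cubes\<close>

text \<open>
  Half-open cubes of one size tile the space, so that dyadic ones are exactly nested or disjoint.
  They differ from the closed cubes of the \<open>A\<^sub>p\<^sup>R\<close> condition by null sets.
\<close>

definition halfopen_cube :: "real ^ 'n \<Rightarrow> real \<Rightarrow> (real ^ 'n) set" where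
  "halfopen_cube a h = {x. \<forall>i. a $ i \<le> x $ i \<and> x $ i < a $ i + h}"

lemma halfopen_cube_between:
  "box a (a + (\<chi> i. h)) \<subseteq> halfopen_cube a h" "halfopen_cube a h \<subseteq> cbox a (a + (\<chi> i. h))"
  by (auto simp: halfopen_cube_def mem_box_cart less_imp_le)

lemma null_set_cbox_diff_halfopen:
  "cbox a (a + (\<chi> i. h)) - halfopen_cube a h \<in> null_sets lebesgue" (is "?N \<in> _")
proof -
  have "?N \<subseteq> frontier (cbox a (a + (\<chi> i. h)))"
    using halfopen_cube_between(1)[of a h] by (auto simp: frontier_def interior_cbox)
  moreover have "negligible (frontier (cbox a (a + (\<chi> i. h))))"
    by (simp add: negligible_convex_frontier)
  ultimately show ?thesis
    using negligible_subset negligible_iff_null_sets by blast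
qed

lemma halfopen_cube_sets [measurable]: "halfopen_cube a h \<in> sets lebesgue"
proof -
  have "halfopen_cube a h = cbox a (a + (\<chi> i. h)) - (cbox a (a + (\<chi> i. h)) - halfopen_cube a h)"
    using halfopen_cube_between(2)[of a h] by blast
  then show ?thesis
    using null_set_cbox_diff_halfopen[of a h]
    by (metis lmeasurable_cbox fmeasurableD null_setsD2 sets.Diff)
qed

lemma halfopen_cube_lmeasurable [simp]: "halfopen_cube a h \<in> lmeasurable"
  using bounded_cbox bounded_subset[OF _ halfopen_cube_between(2)[of a h]]
  by (intro bounded_set_imp_lmeasurable) auto

lemma measure_halfopen_cube:
  assumes "0 < h"
  shows "measure lebesgue (halfopen_cube (a :: real ^ 'n) h) = h ^ CARD('n)"
proof -
  have "measure lebesgue (halfopen_cube a h)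
      = measure lebesgue (halfopen_cube a h \<union> (cbox a (a + (\<chi> i. h)) - halfopen_cube a h))"
    by (subst measure_Un_null_set) (auto simp: null_set_cbox_diff_halfopen)
  also have "halfopen_cube a h \<union> (cbox a (a + (\<chi> i. h)) - halfopen_cube a h) = cbox a (a + (\<chi> i. h))"
    using halfopen_cube_between(2)[of a h] by blast
  also have "measure lebesgue (cbox a (a + (\<chi> i. h))) = (\<Prod>i\<in>(UNIV::'n set). h)"
    using assms by (auto simp: content_cbox_if_cart interval_eq_empty_cart not_less)
  finally show ?thesis by simp
qed

text \<open>
  A dyadic cube is named by its scale \<open>k\<close> (side length \<open>2\<^sup>-\<^sup>k\<close>) and its integer lattice position. Working
  with names keeps the parent and the concentric threefold cube computable from the cube.
\<close>

definition dcube :: "int \<times> (int ^ 'n) \<Rightarrow> (real ^ 'n) set" where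
  "dcube i = {x. \<forall>j. \<lfloor>x $ j * 2 powi fst i\<rfloor> = snd i $ j}"

definition triple_cube :: "int \<times> (int ^ 'n) \<Rightarrow> (real ^ 'n) set" where
  "triple_cube i = {x. \<forall>j. \<bar>\<lfloor>x $ j * 2 powi fst i\<rfloor> - snd i $ j\<bar> \<le> 1}"

definition parent :: "int \<times> (int ^ 'n) \<Rightarrow> int \<times> (int ^ 'n)" where
  "parent i = (fst i - 1, \<chi> j. snd i $ j div 2)"

definition dindex :: "int \<Rightarrow> real ^ 'n \<Rightarrow> int \<times> (int ^ 'n)" where
  "dindex k x = (k, \<chi> j. \<lfloor>x $ j * 2 powi k\<rfloor>)"

lemma mem_dcube_iff: "x \<in> dcube i \<longleftrightarrow> dindex (fst i) x = i"
  by (auto simp: dcube_def dindex_def vec_eq_iff prod_eq_iff)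

lemma mem_dcubeD: "x \<in> dcube i \<Longrightarrow> \<exists>k. i = dindex k x"
  by (rule exI, rule sym, erule iffD1[OF mem_dcube_iff])

lemma mem_dcube_dindex [simp]: "x \<in> dcube (dindex k x)"
  by (simp add: mem_dcube_iff) (simp add: dindex_def)

lemma fst_dindex [simp]: "fst (dindex k x) = k"
  by (simp add: dindex_def)

lemma floor_mult_powi_pred: "\<lfloor>x * 2 powi (k - 1)\<rfloor> = \<lfloor>x * 2 powi k\<rfloor> div 2" for x :: real
proof -
  have "x * 2 powi (k - 1) = (x * 2 powi k) / of_int 2"
    by (simp add: power_int_diff)
  also have "\<lfloor>\<dots>\<rfloor> = \<lfloor>x * 2 powi k\<rfloor> div 2"
    by linarith
  finally show ?thesis .
qed

lemma parent_dindex [simp]: "parent (dindex k x) = dindex (k - 1) x"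
  by (simp add: parent_def dindex_def floor_mult_powi_pred vec_eq_iff)

lemma dcube_halfopen: "dcube i = halfopen_cube (\<chi> j. snd i $ j * 2 powi - fst i) (2 powi - fst i)"
proof -
  have "\<lfloor>t * s\<rfloor> = m \<longleftrightarrow> of_int m * inverse s \<le> t \<and> t < of_int m * inverse s + inverse s"
    if "0 < s" for t s :: real and m :: int
  proof -
    have "\<lfloor>t * s\<rfloor> = m \<longleftrightarrow> of_int m \<le> t * s \<and> t * s < of_int m + 1"
      by linarith
    also have "\<dots> \<longleftrightarrow> of_int m * inverse s \<le> t \<and> t < of_int m * inverse s + inverse s"
      using that by (simp add: field_simps)
    finally show ?thesis .
  qed
  from this[of "2 powi fst i"] show ?thesis
    by (simp add: dcube_def halfopen_cube_def power_int_minus)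
qed

lemma triple_halfopen:
  "triple_cube i = halfopen_cube (\<chi> j. (snd i $ j - 1) * 2 powi - fst i) (3 * 2 powi - fst i)"
proof -
  have "\<bar>\<lfloor>t * s\<rfloor> - m\<bar> \<le> 1 \<longleftrightarrow>
      (real_of_int m - 1) * inverse s \<le> t \<and> t < (real_of_int m - 1) * inverse s + 3 * inverse s"
    if "0 < s" for t s :: real and m :: int
  proof -
    have "\<bar>\<lfloor>t * s\<rfloor> - m\<bar> \<le> 1 \<longleftrightarrow> real_of_int m - 1 \<le> t * s \<and> t * s < real_of_int m + 2"
      by linarith
    also have "\<dots> \<longleftrightarrow> (real_of_int m - 1) * inverse s \<le> t \<and> t < (real_of_int m - 1) * inverse s + 3 * inverse s"
      using that by (simp add: field_simps)
    finally show ?thesis .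
  qed
  from this[of "2 powi fst i"] show ?thesis
    by (simp add: triple_cube_def halfopen_cube_def power_int_minus)
qed

lemma dcube_sets [measurable]: "dcube i \<in> sets lebesgue"
  and triple_sets [measurable]: "triple_cube i \<in> sets lebesgue"
  by (simp_all add: dcube_halfopen triple_halfopen)

lemma measure_dcube: "measure lebesgue (dcube (i :: int \<times> (int ^ 'n))) = (2 powi - fst i) ^ CARD('n)"
  by (simp add: dcube_halfopen measure_halfopen_cube)

lemma measure_triple:
  "measure lebesgue (triple_cube i) = 3 ^ CARD('n) * measure lebesgue (dcube (i :: int \<times> (int ^ 'n)))"
  by (simp add: measure_dcube triple_halfopen measure_halfopen_cube power_mult_distrib)

lemma measure_dcube_pos: "0 < measure lebesgue (dcube i)"
  by (simp add: measure_dcube)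

lemma measure_parent:
  "measure lebesgue (dcube (parent i)) = 2 ^ CARD('n) * measure lebesgue (dcube (i :: int \<times> (int ^ 'n)))"
proof -
  have "2 powi - (fst i - 1) = 2 * (2 :: real) powi - fst i"
    using power_int_add[of "2 :: real" 1 "- fst i"] by simp
  then show ?thesis
    by (simp add: measure_dcube parent_def power_mult_distrib)
qed

lemma dcube_nonempty: "dcube i \<noteq> {}"
  using measure_dcube_pos[of i] by auto

lemma dcube_triple: "dcube i \<subseteq> triple_cube i"
  by (auto simp: dcube_def triple_cube_def)

lemma dcube_parent: "dcube i \<subseteq> dcube (parent i)"
proof
  fix x assume "x \<in> dcube i"
  then obtain k where "i = dindex k x" by (blast dest: mem_dcubeD)
  then show "x \<in> dcube (parent i)" by simp
qed

lemma triple_parent: "triple_cube i \<subseteq> triple_cube (parent i)"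
proof
  fix x assume "x \<in> triple_cube i"
  then have "\<bar>\<lfloor>x $ j * 2 powi fst i\<rfloor> - snd i $ j\<bar> \<le> 1" for j
    by (auto simp: triple_cube_def)
  moreover have "\<bar>a div 2 - b div 2\<bar> \<le> 1" if "\<bar>a - b\<bar> \<le> 1" for a b :: int
    using that by linarith
  ultimately have "\<bar>\<lfloor>x $ j * 2 powi fst i\<rfloor> div 2 - snd i $ j div 2\<bar> \<le> 1" for j
    by blast
  then show "x \<in> triple_cube (parent i)"
    by (simp add: triple_cube_def parent_def floor_mult_powi_pred)
qed

lemma ancestor_dindex: "(parent ^^ n) (dindex k x) = dindex (k - int n) x"
  by (induction n) (auto simp: algebra_simps)

lemma dcube_ancestor: "dcube i \<subseteq> dcube ((parent ^^ n) i)"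
  by (induction n) (simp, simp add: order_trans[OF _ dcube_parent])

lemma triple_ancestor: "triple_cube i \<subseteq> triple_cube ((parent ^^ n) i)"
  by (induction n) (simp, simp add: order_trans[OF _ triple_parent])

text \<open>
  Both cubes contain a common point \<open>x\<close>, hence both are the cube of \<open>x\<close> at their scale, and the
  chain of ancestors of the finer one runs through all cubes of \<open>x\<close> at coarser scales.
\<close>

lemma ancestor_if_meets:
  assumes "dcube i \<inter> dcube j \<noteq> {}" "fst j \<le> fst i"
  shows "(parent ^^ nat (fst i - fst j)) i = j"
proof -
  obtain x where "x \<in> dcube i" "x \<in> dcube j" using assms by auto
  then obtain k l where "i = dindex k x" "j = dindex l x" by (blast dest: mem_dcubeD)
  with assms(2) show ?thesis by (simp add: ancestor_dindex)
qed

lemma dcube_nested_or_disjoint: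
  "dcube i \<inter> dcube j = {} \<or> dcube i \<subseteq> dcube j \<or> dcube j \<subseteq> dcube i"
proof (cases "dcube i \<inter> dcube j = {}")
  case False
  then show ?thesis
    using ancestor_if_meets[of i j] ancestor_if_meets[of j i]
      dcube_ancestor[of i "nat (fst i - fst j)"] dcube_ancestor[of j "nat (fst j - fst i)"]
    by (cases "fst j \<le> fst i") (auto simp: Int_commute)
qed simp

lemma dcube_subset_imp_le:
  assumes "dcube i \<subseteq> dcube (j :: int \<times> (int ^ 'n))" shows "fst j \<le> fst i"
proof -
  have "measure lebesgue (dcube i) \<le> measure lebesgue (dcube j)"
    using assms by (intro measure_mono_fmeasurable) (auto simp: dcube_halfopen)
  then have "(2 :: real) powi - fst i \<le> 2 powi - fst j"
    by (simp add: measure_dcube power_mono_iff)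
  moreover have "(2 :: real) powi - fst j < 2 powi - fst i" if "fst i < fst j"
    using that by (intro power_int_strict_increasing) auto
  ultimately show ?thesis by (meson not_le)
qed

lemma dcube_inj: assumes "dcube i = dcube j" shows "i = j"
proof -
  have "fst i = fst j"
    using assms dcube_subset_imp_le[of i j] dcube_subset_imp_le[of j i] by auto
  then show ?thesis
    using ancestor_if_meets[of i j] assms dcube_nonempty[of i] by simp
qed

lemma parent_if_psubset:
  assumes "dcube i \<subset> dcube j" shows "dcube (parent i) \<subseteq> dcube j"
proof -
  define d where "d = nat (fst i - fst j)"
  have j: "(parent ^^ d) i = j"
    unfolding d_def using assms dcube_nonempty[of i] dcube_subset_imp_le[of i j]
    by (intro ancestor_if_meets) auto
  with assms have "d \<noteq> 0" by (metis funpow_0 less_irrefl)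
  then obtain d' where "d = Suc d'" using not0_implies_Suc by blast
  with j show ?thesis by (metis dcube_ancestor comp_apply funpow_Suc_right)
qed

section \<open>Neighbours and maximal cubes of a finite family\<close>

definition neighbours :: "int \<times> (int ^ 'n) \<Rightarrow> (int \<times> (int ^ 'n)) set" where
  "neighbours i = {l. fst l = fst i \<and> (\<forall>j. \<bar>snd l $ j - snd i $ j\<bar> \<le> 1)}"

lemma finite_neighbours: "finite (neighbours i)"
proof -
  have "neighbours i \<subseteq> (\<lambda>g. (fst i, \<chi> j. g j)) ` Pi UNIV (\<lambda>j. {snd i $ j - 1 .. snd i $ j + 1})"
  proof
    fix l assume l: "l \<in> neighbours i"
    have "snd i $ j - 1 \<le> snd l $ j \<and> snd l $ j \<le> snd i $ j + 1" for j
    proof -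
      have "\<bar>snd l $ j - snd i $ j\<bar> \<le> 1" using l by (simp add: neighbours_def)
      then show ?thesis by linarith
    qed
    then have "($) (snd l) \<in> Pi UNIV (\<lambda>j. {snd i $ j - 1 .. snd i $ j + 1})"
      by auto
    moreover have "l = (fst i, \<chi> j. snd l $ j)" using l by (simp add: neighbours_def prod_eq_iff)
    ultimately show "l \<in> (\<lambda>g. (fst i, \<chi> j. g j)) ` Pi UNIV (\<lambda>j. {snd i $ j - 1 .. snd i $ j + 1})"
      by (rule rev_image_eqI[where f = "\<lambda>g. (fst i, \<chi> j. g j)"])
  qed
  moreover have "finite (Pi UNIV (\<lambda>j. {snd i $ j - 1 .. snd i $ j + 1}))"
    unfolding PiE_UNIV_domain[symmetric] by (rule finite_PiE) auto
  ultimately show ?thesis by (meson finite_imageI finite_subset)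
qed

lemma triple_cube_UN: "triple_cube i = (\<Union>l\<in>neighbours i. dcube l)"
proof (intro equalityI subsetI)
  fix x assume "x \<in> triple_cube i"
  then have "dindex (fst i) x \<in> neighbours i"
    by (auto simp: triple_cube_def neighbours_def dindex_def)
  then show "x \<in> (\<Union>l\<in>neighbours i. dcube l)" by (rule UN_I) simp
next
  fix x assume "x \<in> (\<Union>l\<in>neighbours i. dcube l)"
  then obtain l where "l \<in> neighbours i" "x \<in> dcube l" by blast
  then show "x \<in> triple_cube i" by (simp add: triple_cube_def neighbours_def dcube_def)
qed

lemma disjoint_same_scale: 
  assumes "\<And>i. i \<in> I \<Longrightarrow> fst i = k"
  shows "disjoint_family_on dcube I"
  unfolding disjoint_family_on_def
proof (intro ballI impI)
  fix i j assume "i \<in> I" "j \<in> I" "i \<noteq> j"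
  with assms have "fst i = fst j" by simp
  with ancestor_if_meets[of i j] \<open>i \<noteq> j\<close> show "dcube i \<inter> dcube j = {}" by auto
qed

lemma dcube_lmeasurable [simp]: "dcube i \<in> lmeasurable"
  and triple_lmeasurable [simp]: "triple_cube i \<in> lmeasurable"
  by (simp_all add: dcube_halfopen triple_halfopen)

text \<open>
  The threefold cube has \<open>3\<^sup>n\<close> times the volume of the cube and is tiled by the neighbours, so the
  count follows by comparing volumes.
\<close>

lemma card_neighbours: "card (neighbours (i :: int \<times> (int ^ 'n))) = 3 ^ CARD('n)"
proof -
  have "measure lebesgue (triple_cube i) = (\<Sum>l\<in>neighbours i. measure lebesgue (dcube l))"
    unfolding triple_cube_UN
  proof (intro measure_finite_Union finite_neighbours)
    show "disjoint_family_on dcube (neighbours i)"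
      by (rule disjoint_same_scale) (simp add: neighbours_def)
    show "emeasure lebesgue (dcube l) \<noteq> \<infinity>" for l :: "int \<times> (int ^ 'n)"
      using fmeasurableD2[OF dcube_lmeasurable] by simp
  qed auto
  also have "\<dots> = card (neighbours i) * measure lebesgue (dcube i)"
    by (simp add: neighbours_def measure_dcube)
  finally have "real (card (neighbours i)) = 3 ^ CARD('n)"
    using measure_dcube_pos[of i] by (simp add: measure_triple)
  then show ?thesis by (metis of_nat_eq_iff of_nat_numeral of_nat_power)
qed

text \<open>
  Nestedness makes the maximal cubes of a finite family disjoint with the same union. An infinite
  family need not have maximal cubes; therefore the level set is approximated by finitely many
  stopping cubes, with bounds that do not depend on the approximation.
\<close>

definition maximal_cubes :: "(int \<times> (int ^ 'n)) set \<Rightarrow> (int \<times> (int ^ 'n)) set" where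
  "maximal_cubes F = {i \<in> F. \<forall>j\<in>F. \<not> dcube i \<subset> dcube j}"

lemma maximal_cubes_subset: "maximal_cubes F \<subseteq> F"
  by (auto simp: maximal_cubes_def)

lemma disjoint_maximal_cubes: "disjoint_family_on dcube (maximal_cubes F)"
proof -
  have "dcube i \<inter> dcube j = {}" if "i \<in> maximal_cubes F" "j \<in> maximal_cubes F" "i \<noteq> j" for i j
  proof -
    have "\<not> dcube i \<subset> dcube j" "\<not> dcube j \<subset> dcube i" "dcube i \<noteq> dcube j"
      using that dcube_inj[of i j] by (auto simp only: maximal_cubes_def mem_Collect_eq)
    with dcube_nested_or_disjoint[of i j] show ?thesis by blast
  qed
  then show ?thesis unfolding disjoint_family_on_def by blast
qed

lemma ex_maximal_cube:
  assumes "finite F" "i \<in> F"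
  shows "\<exists>j\<in>maximal_cubes F. dcube i \<subseteq> dcube j"
proof -
  obtain Q where Q: "Q \<in> dcube ` F" "dcube i \<subseteq> Q" "\<forall>R\<in>dcube ` F. Q \<subseteq> R \<longrightarrow> Q = R"
    using finite_has_maximal2[OF finite_imageI[OF assms(1)] imageI[OF assms(2)], of dcube] by metis
  then obtain j where "j \<in> F" "Q = dcube j" by blast
  moreover from this Q have "j \<in> maximal_cubes F"
    by (simp add: maximal_cubes_def psubset_eq)
  ultimately show ?thesis using Q(2) by blast
qed

lemma UN_maximal_cubes:
  assumes "finite F" shows "(\<Union>i\<in>maximal_cubes F. dcube i) = (\<Union>i\<in>F. dcube i)"
proof
  show "(\<Union>i\<in>F. dcube i) \<subseteq> (\<Union>i\<in>maximal_cubes F. dcube i)"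
  proof (rule UN_least)
    fix i assume "i \<in> F"
    with assms obtain j where "j \<in> maximal_cubes F" "dcube i \<subseteq> dcube j"
      using ex_maximal_cube by blast
    then show "dcube i \<subseteq> (\<Union>i\<in>maximal_cubes F. dcube i)" by blast
  qed
qed (intro UN_mono maximal_cubes_subset order_refl)

section \<open>Weights and the restricted Muckenhoupt inequality\<close>

\<comment> \<open>Keeps Lebesgue measures folded instead of rewriting them to Borel parts of the sets.\<close>
declare emeasure_completion [simp del]

lemma sets_weight_measure [simp, measurable_cong]: "sets (weight_measure w) = sets lebesgue"
  by (simp add: weight_measure_def)

lemma space_weight_measure [simp]: "space (weight_measure w) = UNIV"
  by (simp add: weight_measure_def)

lemma weight_measurable:
  assumes "weight w" shows "w \<in> borel_measurable lebesgue"
proof (rule borel_measurable_LIMSEQ_real)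
  show "(\<lambda>k. indicat_real (cball 0 (real k)) x *\<^sub>R w x) \<longlonglongrightarrow> w x" for x
  proof (rule tendsto_eventually)
    obtain k0 where "norm x \<le> real k0" using real_arch_simple by blast
    then show "\<forall>\<^sub>F k in sequentially. indicat_real (cball 0 (real k)) x *\<^sub>R w x = w x"
      by (intro eventually_sequentiallyI[of k0]) (auto simp: indicator_def)
  qed
  show "(\<lambda>x. indicat_real (cball 0 (real k)) x *\<^sub>R w x) \<in> borel_measurable lebesgue" for k
    using assms unfolding weight_def set_integrable_def by (metis borel_measurable_integrable compact_cball)
qed

lemma weight_pos: "weight w \<Longrightarrow> 0 < w x"
  by (simp add: weight_def)

lemma emeasure_weight:
  assumes "weight w" "S \<in> sets lebesgue"
  shows "emeasure (weight_measure w) S = (\<integral>\<^sup>+x\<in>S. ennreal (w x) \<partial>lebesgue)"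
  unfolding weight_measure_def using weight_measurable[OF assms(1)] assms(2)
  by (intro emeasure_density) auto

lemma emeasure_weight_finite:
  assumes "weight w" "bounded S"
  shows "emeasure (weight_measure w) S < \<infinity>"
proof -
  obtain a b where ab: "S \<subseteq> cbox a b"
    using assms(2) bounded_subset_cbox_symmetric by blast
  have "integrable lebesgue (\<lambda>x. indicat_real (cbox a b) x *\<^sub>R w x)"
    using assms(1) by (simp add: weight_def set_integrable_def compact_cbox)
  then have "(\<integral>\<^sup>+x. norm (indicat_real (cbox a b) x *\<^sub>R w x) \<partial>lebesgue) < \<infinity>"
    by (simp add: integrable_iff_bounded)
  moreover have "ennreal (norm (indicat_real (cbox a b) x *\<^sub>R w x)) = ennreal (w x) * indicator (cbox a b) x" for x
    using weight_pos[OF assms(1), of x] by (auto simp: indicator_def)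
  ultimately have "emeasure (weight_measure w) (cbox a b) < \<infinity>"
    by (simp add: emeasure_weight[OF assms(1)])
  then show ?thesis
    by (rule le_less_trans[rotated]) (use ab in \<open>auto intro!: emeasure_mono\<close>)
qed

lemma emeasure_weight_eq_0_iff:
  assumes "weight w" "S \<in> sets lebesgue"
  shows "emeasure (weight_measure w) S = 0 \<longleftrightarrow> emeasure lebesgue S = 0"
proof -
  have "emeasure (weight_measure w) S = 0 \<longleftrightarrow> (AE x in lebesgue. \<not> (x \<in> S \<and> 0 < w x))"
    using assms weight_measurable[OF assms(1)]
    by (subst emeasure_weight)
      (auto simp: nn_integral_0_iff_AE indicator_def not_less ennreal_eq_0_iff intro!: AE_cong)
  also have "\<dots> \<longleftrightarrow> emeasure lebesgue S = 0"
    using assms by (simp add: weight_pos AE_iff_measurable[OF _ refl])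
  finally show ?thesis .
qed

lemma bounded_halfopen_cube [simp]: "bounded (halfopen_cube a h)"
  using bounded_cbox bounded_subset[OF _ halfopen_cube_between(2)[of a h]] by blast

lemma bounded_dcube [simp]: "bounded (dcube i)" and bounded_triple_cube [simp]: "bounded (triple_cube i)"
  by (simp_all add: dcube_halfopen triple_halfopen)

lemma weight_fmeasurable:
  assumes "weight w" "bounded S" "S \<in> sets lebesgue"
  shows "S \<in> fmeasurable (weight_measure w)"
  using emeasure_weight_finite[OF assms(1,2)] assms(3) by (auto simp: fmeasurable_def)

lemma measure_weight_mono:
  assumes "weight w" "bounded T" "T \<in> sets lebesgue" "S \<subseteq> T" "S \<in> sets lebesgue"
  shows "measure (weight_measure w) S \<le> measure (weight_measure w) T"
  using assms by (intro measure_mono_fmeasurable weight_fmeasurable) auto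

lemma measure_weight_dcube_pos:
  assumes "weight w" shows "0 < measure (weight_measure w) (dcube i)"
proof -
  have "emeasure lebesgue (dcube i) \<noteq> 0"
    using measure_dcube_pos[of i] by (auto simp: measure_def)
  then show ?thesis
    using emeasure_weight_finite[OF assms, of "dcube i"] emeasure_weight_eq_0_iff[OF assms, of "dcube i"]
    by (simp add: measure_def enn2real_positive_iff zero_less_iff_neq_zero)
qed

text \<open>
  This is the \<open>A\<^sub>q\<^sup>R\<close> condition after testing against characteristic functions:
  \<open>|S| / |Q| \<le> K\<^bsup>1/q\<^esup> (w(S) / w(Q))\<^bsup>1/q\<^esup>\<close> for \<open>S \<subseteq> Q\<close>. It is written without division, and it is
  unchanged when \<open>w\<close> is multiplied by a constant, which is what permits the level \<open>y\<close> of a weak type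
  estimate to be absorbed into the weight.
\<close>

definition restricted_Ap :: "real \<Rightarrow> real \<Rightarrow> (real ^ 'n \<Rightarrow> real) \<Rightarrow> bool" where
  "restricted_Ap q K w \<longleftrightarrow> (\<forall>a h S. 0 < h \<longrightarrow> S \<in> sets lebesgue \<longrightarrow> S \<subseteq> halfopen_cube a h \<longrightarrow>
     measure (weight_measure w) (halfopen_cube a h) * measure lebesgue S powr q
       \<le> K * measure lebesgue (halfopen_cube a h) powr q * measure (weight_measure w) S)"

lemma restricted_Ap_dcube:
  assumes "restricted_Ap q K w" "S \<in> sets lebesgue" "S \<subseteq> dcube i"
  shows "measure (weight_measure w) (dcube i) * measure lebesgue S powr q
       \<le> K * measure lebesgue (dcube i) powr q * measure (weight_measure w) S"
  using assms by (auto simp: restricted_Ap_def dcube_halfopen)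

lemma restricted_Ap_triple:
  assumes "restricted_Ap q K w" "S \<in> sets lebesgue" "S \<subseteq> triple_cube i"
  shows "measure (weight_measure w) (triple_cube i) * measure lebesgue S powr q
       \<le> K * measure lebesgue (triple_cube i) powr q * measure (weight_measure w) S"
  using assms by (auto simp: restricted_Ap_def triple_halfopen)

lemma restricted_Ap_ge_1:
  assumes "restricted_Ap q K w" "weight (w :: real ^ 'n \<Rightarrow> real)" shows "1 \<le> K"
proof -
  let ?Q = "dcube (0, 0) :: (real ^ 'n) set"
  have "1 * (measure (weight_measure w) ?Q * measure lebesgue ?Q powr q)
      \<le> K * (measure (weight_measure w) ?Q * measure lebesgue ?Q powr q)"
    using restricted_Ap_dcube[OF assms(1), of ?Q "(0, 0)"] by (simp add: mult_ac)
  moreover have "0 < measure (weight_measure w) ?Q * measure lebesgue ?Q powr q"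
    using measure_weight_dcube_pos[OF assms(2)] measure_dcube_pos by (metis mult_pos_pos powr_gt_zero less_irrefl)
  ultimately show ?thesis by (metis mult_le_cancel_right_pos)
qed

lemma measure_weight_triple_le:
  assumes "restricted_Ap q K w"
  shows "measure (weight_measure w) (triple_cube (i :: int \<times> (int ^ 'n)))
    \<le> K * (3 ^ CARD('n)) powr q * measure (weight_measure w) (dcube i)"
  using restricted_Ap_triple[OF assms dcube_sets dcube_triple, of i] measure_dcube_pos[of i]
  by (simp add: measure_triple powr_mult mult_ac)

lemma open_contains_dcube:
  assumes "open U" "(x :: real ^ 'n) \<in> U"
  obtains k where "\<And>l. k \<le> l \<Longrightarrow> dcube (dindex l x) \<subseteq> U"
proof -
  obtain e where e: "0 < e" "ball x e \<subseteq> U"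
    using assms open_contains_ball by blast
  obtain m :: nat where m: "(1 / 2) ^ m < e / CARD('n)"
    using real_arch_pow_inv[of "e / CARD('n)" "1 / 2"] e(1) by auto
  have "dcube (dindex (int m) x) \<subseteq> ball x e"
  proof
    fix y assume "y \<in> dcube (dindex (int m) x)"
    then have y: "\<lfloor>y $ j * 2 ^ m\<rfloor> = \<lfloor>x $ j * 2 ^ m\<rfloor>" for j
      by (simp add: dcube_def dindex_def)
    have "\<bar>(x - y) $ j\<bar> \<le> (1 / 2) ^ m" for j
    proof -
      have "\<bar>x $ j * 2 ^ m - y $ j * 2 ^ m\<bar> \<le> 1" using y[of j] by linarith
      then have "\<bar>x $ j - y $ j\<bar> * 2 ^ m \<le> 1"
        by (simp add: abs_mult left_diff_distrib[symmetric])
      then show ?thesis by (simp add: field_simps power_one_over)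
    qed
    then have "norm (x - y) \<le> (\<Sum>j\<in>(UNIV :: 'n set). (1 / 2) ^ m)"
      by (intro order_trans[OF norm_le_l1_cart] sum_mono) auto
    also have "\<dots> < e" using m by (simp add: field_simps)
    finally show "y \<in> ball x e" by (simp add: dist_norm)
  qed
  moreover have "dcube (dindex l x) \<subseteq> dcube (dindex (int m) x)" if "int m \<le> l" for l
    using dcube_ancestor[of "dindex l x" "nat (l - int m)"] that by (simp add: ancestor_dindex)
  ultimately show ?thesis using that[of "int m"] e(2) by blast
qed

text \<open>
  Estimates on the members of a countable disjoint family add up; applied once to transfer
  volumes and once to transfer weights from stopping cubes to their union.
\<close>

lemma emeasure_UN_mono_disjoint:
  assumes "countable I" "disjoint_family_on X I" "disjoint_family_on Y I"
    and "\<And>i. i \<in> I \<Longrightarrow> X i \<in> sets M" "\<And>i. i \<in> I \<Longrightarrow> Y i \<in> sets N"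
    and "\<And>i. i \<in> I \<Longrightarrow> emeasure M (X i) \<le> c * emeasure N (Y i)"
  shows "emeasure M (\<Union>i\<in>I. X i) \<le> c * emeasure N (\<Union>i\<in>I. Y i)"
proof -
  have "emeasure M (\<Union>i\<in>I. X i) = (\<integral>\<^sup>+i. emeasure M (X i) \<partial>count_space I)"
    using assms by (intro emeasure_UN_countable)
  also have "\<dots> \<le> (\<integral>\<^sup>+i. c * emeasure N (Y i) \<partial>count_space I)"
    using assms(6) by (intro nn_integral_mono) auto
  also have "\<dots> = c * (\<integral>\<^sup>+i. emeasure N (Y i) \<partial>count_space I)"
    by (rule nn_integral_cmult) auto
  also have "\<dots> = c * emeasure N (\<Union>i\<in>I. Y i)"
    using assms by (subst emeasure_UN_countable) auto
  finally show ?thesis .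
qed

section \<open>Power decay of the weight of small sets\<close>

text \<open>
  Open sets of the dyadic topology. Small dyadic cubes around a point of such a set have density
  one, so the stopping cubes of \<open>stopping_cubes\<close> cover the set everywhere, not only up to a null set.
  Outer regularity passes to general sets afterwards (\<open>weight_decay\<close>).
\<close>

definition dyadic_open :: "(real ^ 'n) set \<Rightarrow> bool" where
  "dyadic_open S \<longleftrightarrow> (\<forall>x\<in>S. \<exists>k. \<forall>l\<ge>k. dcube (dindex l x) \<subseteq> S)"

lemma dindex_nested: "k \<le> l \<Longrightarrow> dcube (dindex l x) \<subseteq> dcube (dindex k x)"
  using dcube_ancestor[of "dindex l x" "nat (l - k)"] by (simp add: ancestor_dindex)

lemma dyadic_open_dcube: "dyadic_open (dcube i)"
proof -
  have "\<exists>k. \<forall>l\<ge>k. dcube (dindex l x) \<subseteq> dcube i" if "x \<in> dcube i" for x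
    using mem_dcubeD[OF that] dindex_nested by blast
  then show ?thesis by (auto simp only: dyadic_open_def)
qed

lemma dyadic_open_UN: "(\<And>i. i \<in> I \<Longrightarrow> dyadic_open (X i)) \<Longrightarrow> dyadic_open (\<Union>i\<in>I. X i)"
  unfolding dyadic_open_def by (meson UN_E UN_upper order_trans)

lemma dyadic_open_Int_open:
  assumes "open U" shows "dyadic_open (U \<inter> dcube i)"
  unfolding dyadic_open_def
proof
  fix x assume x: "x \<in> U \<inter> dcube i"
  obtain k where k: "\<And>l. k \<le> l \<Longrightarrow> dcube (dindex l x) \<subseteq> U"
    using open_contains_dcube[OF assms, of x] x by blast
  obtain k' where k': "\<And>l. k' \<le> l \<Longrightarrow> dcube (dindex l x) \<subseteq> dcube i"
    using dyadic_open_dcube[of i] x unfolding dyadic_open_def by blast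
  show "\<exists>k. \<forall>l\<ge>k. dcube (dindex l x) \<subseteq> U \<inter> dcube i"
    using k k' by (intro exI[of _ "max k k'"]) auto
qed

lemma Int_dcube_lmeasurable [simp]:
  assumes "S \<in> sets lebesgue" shows "S \<inter> dcube i \<in> lmeasurable"
  using fmeasurable_Int_fmeasurable[OF dcube_lmeasurable assms, of i] by (simp add: Int_commute)

text \<open>
  The Calderon-Zygmund decomposition of the indicator function of \<open>S\<close> at height \<open>\<epsilon>\<close> inside a dyadic
  cube. The upper density bound comes from the parent, in which \<open>S\<close> has density at most \<open>\<epsilon>\<close>.
\<close>

lemma stopping_cubes:
  assumes S: "dyadic_open S" "S \<in> sets lebesgue" "S \<subseteq> dcube (i :: int \<times> (int ^ 'n))"
    and \<epsilon>: "0 < \<epsilon>" "\<epsilon> < 1" "measure lebesgue S \<le> \<epsilon> * measure lebesgue (dcube i)"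
  obtains I where "disjoint_family_on dcube I" "S \<subseteq> (\<Union>l\<in>I. dcube l)"
    "\<And>l. l \<in> I \<Longrightarrow> dcube l \<subseteq> dcube i"
    "\<And>l. l \<in> I \<Longrightarrow> \<epsilon> * measure lebesgue (dcube l) < measure lebesgue (S \<inter> dcube l)"
    "\<And>l. l \<in> I \<Longrightarrow> measure lebesgue (S \<inter> dcube l) \<le> 2 ^ CARD('n) * \<epsilon> * measure lebesgue (dcube l)"
proof -
  define big where "big l \<longleftrightarrow> \<epsilon> * measure lebesgue (dcube l) < measure lebesgue (S \<inter> dcube l)" for l
  define I where "I = {l. dcube l \<subseteq> dcube i \<and> big l \<and> (\<forall>j. dcube j \<subseteq> dcube i \<longrightarrow> dcube l \<subset> dcube j \<longrightarrow> \<not> big j)}"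
  have "dcube l \<inter> dcube j = {}" if "l \<in> I" "j \<in> I" "l \<noteq> j" for l j
  proof -
    have "\<not> dcube l \<subset> dcube j" "\<not> dcube j \<subset> dcube l" "dcube l \<noteq> dcube j"
      using that dcube_inj[of l j] by (auto simp only: I_def mem_Collect_eq)
    with dcube_nested_or_disjoint[of l j] show ?thesis by blast
  qed
  then have 1: "disjoint_family_on dcube I" unfolding disjoint_family_on_def by blast
  have 2: "S \<subseteq> (\<Union>l\<in>I. dcube l)"
  proof
    fix x assume "x \<in> S"
    then have "x \<in> dcube i" using S by blast
    then have i: "dindex (fst i) x = i" by (simp add: mem_dcube_iff)
    obtain k where k: "\<And>l. k \<le> l \<Longrightarrow> dcube (dindex l x) \<subseteq> S"
      using S(1) \<open>x \<in> S\<close> unfolding dyadic_open_def by blast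
    define P where "P d \<longleftrightarrow> big (dindex (fst i + int d) x)" for d
    have "P (nat (k - fst i))"
    proof -
      define j where "j = dindex (fst i + int (nat (k - fst i))) x"
      have "S \<inter> dcube j = dcube j"
        using k[of "fst i + int (nat (k - fst i))"] by (auto simp: j_def)
      then have "big j" using \<epsilon> measure_dcube_pos[of j] by (simp add: big_def)
      then show ?thesis by (simp only: P_def j_def)
    qed
    then have P: "P (LEAST d. P d)" by (rule LeastI)
    define l where "l = dindex (fst i + int (LEAST d. P d)) x"
    have "dcube l \<subseteq> dcube i"
      using dindex_nested[of "fst i" "fst i + int (LEAST d. P d)" x] by (simp add: l_def i)
    moreover have "big l" using P by (simp add: P_def l_def)
    moreover have "\<not> big j" if j: "dcube j \<subseteq> dcube i" "dcube l \<subset> dcube j" for j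
    proof -
      have "x \<in> dcube j" using j(2) mem_dcube_dindex unfolding l_def by blast
      then have j_eq: "dindex (fst j) x = j" by (simp add: mem_dcube_iff)
      have "fst j < fst l"
      proof (rule ccontr)
        assume "\<not> fst j < fst l"
        then have "dcube j \<subseteq> dcube l"
          using dindex_nested[of "fst l" "fst j" x] by (simp add: l_def j_eq)
        with j(2) show False by blast
      qed
      moreover have "fst i \<le> fst j" using dcube_subset_imp_le[OF j(1)] .
      ultimately have "\<not> P (nat (fst j - fst i))"
        by (intro not_less_Least) (simp add: l_def)
      then show ?thesis using \<open>fst i \<le> fst j\<close> j_eq by (simp add: P_def)
    qed
    ultimately have "l \<in> I" unfolding I_def by blast
    then show "x \<in> (\<Union>l\<in>I. dcube l)" by (rule UN_I) (simp add: l_def)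
  qed
  have 3: "measure lebesgue (S \<inter> dcube l) \<le> 2 ^ CARD('n) * \<epsilon> * measure lebesgue (dcube l)" if "l \<in> I" for l
  proof -
    have l: "dcube l \<subseteq> dcube i" "big l" using that unfolding I_def by blast+
    have "dcube l \<noteq> dcube i"
    proof
      assume "dcube l = dcube i"
      then have "S \<inter> dcube l = S" using S(3) by blast
      with l(2) \<epsilon>(3) \<open>dcube l = dcube i\<close> show False by (simp add: big_def)
    qed
    with l have "dcube (parent l) \<subseteq> dcube i" by (intro parent_if_psubset) blast
    moreover have "dcube l \<subset> dcube (parent l)"
      using dcube_parent[of l] dcube_inj[of l "parent l"] by (auto simp: parent_def prod_eq_iff)
    ultimately have "\<not> big (parent l)" using that unfolding I_def by blast
    then have "measure lebesgue (S \<inter> dcube (parent l)) \<le> 2 ^ CARD('n) * \<epsilon> * measure lebesgue (dcube l)"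
      by (simp add: big_def measure_parent not_less mult_ac)
    moreover have "measure lebesgue (S \<inter> dcube l) \<le> measure lebesgue (S \<inter> dcube (parent l))"
      using dcube_parent[of l] S(2) by (intro measure_mono_fmeasurable) auto
    ultimately show ?thesis by linarith
  qed
  show ?thesis
  proof (rule that[OF 1 2 _ _ 3])
    show "dcube l \<subseteq> dcube i" "\<epsilon> * measure lebesgue (dcube l) < measure lebesgue (S \<inter> dcube l)" if "l \<in> I" for l
      using that unfolding I_def big_def by blast+
  qed
qed

text \<open>
  If \<open>S\<close> occupies at most half of \<open>Q\<close>, its complement occupies at least half, and the restricted
  inequality applied to the complement gives it a fixed fraction of \<open>w(Q)\<close>.
\<close>

lemma restricted_Ap_complement:
  assumes Ap: "restricted_Ap q K w" and w: "weight w" and q: "0 \<le> q"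
    and S: "S \<in> sets lebesgue" "S \<subseteq> dcube i" "measure lebesgue S \<le> measure lebesgue (dcube i) / 2"
  shows "measure (weight_measure w) (dcube i) \<le> 2 powr q * K * measure (weight_measure w) (dcube i - S)"
proof -
  let ?Q = "dcube i" and ?w = "measure (weight_measure w)"
  have "measure lebesgue (?Q - S) = measure lebesgue ?Q - measure lebesgue S"
    using measure_Diff[of lebesgue ?Q S] fmeasurableD2[OF dcube_lmeasurable[of i]] S
    by (simp del: emeasure_completion)
  then have "measure lebesgue ?Q / 2 \<le> measure lebesgue (?Q - S)" using S(3) by linarith
  then have "?w ?Q * (measure lebesgue ?Q / 2) powr q \<le> ?w ?Q * measure lebesgue (?Q - S) powr q"
    using q by (intro mult_left_mono powr_mono2) auto
  also have "\<dots> \<le> K * measure lebesgue ?Q powr q * ?w (?Q - S)"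
    using S(1) by (intro restricted_Ap_dcube[OF Ap]) auto
  finally have "?w ?Q * (measure lebesgue ?Q powr q / 2 powr q) \<le> K * measure lebesgue ?Q powr q * ?w (?Q - S)"
    by (simp add: powr_divide)
  then show ?thesis using measure_dcube_pos[of i] by (simp add: field_simps)
qed

text \<open>
  The fraction of \<open>w(Q)\<close> that half of \<open>Q\<close> can carry at most. The geometric series with this ratio
  sums to \<open>2\<^sup>q K\<close>, so the final constant stays polynomial in \<open>K\<close>.
\<close>

definition decay_rate :: "real \<Rightarrow> real \<Rightarrow> real" where
  "decay_rate q K = 1 - 1 / (2 powr q * K)"

lemma decay_rate_bounds: 
  assumes "0 \<le> q" "1 \<le> K" shows "0 \<le> decay_rate q K" "decay_rate q K < 1"
proof -
  have "1 * 1 \<le> 2 powr q * K" using assms by (intro mult_mono) (auto simp: ge_one_powr_ge_zero)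
  then show "0 \<le> decay_rate q K" "decay_rate q K < 1" using assms by (auto simp: decay_rate_def)
qed

lemma measure_weight_half_le:
  assumes Ap: "restricted_Ap q K w" and w: "weight w" and q: "0 \<le> q"
    and S: "S \<in> sets lebesgue" "S \<subseteq> dcube i" "measure lebesgue S \<le> measure lebesgue (dcube i) / 2"
  shows "measure (weight_measure w) S \<le> decay_rate q K * measure (weight_measure w) (dcube i)"
proof -
  let ?Q = "dcube i" and ?w = "measure (weight_measure w)"
  have "?w (?Q - S) = ?w ?Q - ?w S"
    using S emeasure_weight_finite[OF w, of ?Q] by (intro measure_Diff) auto
  moreover have "?w ?Q / (2 powr q * K) \<le> ?w (?Q - S)"
    using restricted_Ap_complement[OF assms] restricted_Ap_ge_1[OF Ap w]
    by (simp add: divide_le_eq mult_ac)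
  ultimately show ?thesis by (simp add: decay_rate_def left_diff_distrib)
qed

text \<open>
  Each passage from \<open>S\<close> to the union \<open>G\<close> of its stopping cubes at height \<open>2\<^bsup>-n-1\<^esup>\<close> costs a factor
  \<open>2\<^bsup>n+1\<^esup>\<close> in volume, while \<open>S\<close> fills at most half of every stopping cube, so it gains the factor
  \<open>decay_rate\<close> in weight. A set of relative volume \<open>2\<^bsup>-(n+1)m\<^esup>\<close> admits \<open>m\<close> such passages.
\<close>

lemma weight_decay_dyadic_open:
  assumes Ap: "restricted_Ap q K w" and w: "weight w" and q: "0 \<le> q"
  shows "dyadic_open S \<Longrightarrow> S \<in> sets lebesgue \<Longrightarrow> S \<subseteq> dcube (i :: int \<times> (int ^ 'n)) \<Longrightarrow>
    measure lebesgue S \<le> (1 / 2 ^ (CARD('n) + 1)) ^ m * measure lebesgue (dcube i) \<Longrightarrow>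
    measure (weight_measure w) S \<le> decay_rate q K ^ m * measure (weight_measure w) (dcube i)"
proof (induction m arbitrary: S)
  case 0
  then show ?case using measure_weight_mono[OF w, of "dcube i" S] by simp
next
  case (Suc m)
  define \<epsilon> :: real where "\<epsilon> = 1 / 2 ^ (CARD('n) + 1)"
  have "1 < 2 * (2 :: real) ^ CARD('n)"
    using one_le_power[of "2 :: real" "CARD('n)"] by linarith
  then have \<epsilon>: "0 < \<epsilon>" "\<epsilon> < 1" "\<epsilon> \<le> 1" by (auto simp: \<epsilon>_def field_simps)
  note rate = decay_rate_bounds[OF q restricted_Ap_ge_1[OF Ap w]]
  have "measure lebesgue S \<le> \<epsilon> ^ Suc m * measure lebesgue (dcube i)"
    using Suc.prems by (simp add: \<epsilon>_def)
  also have "\<dots> \<le> \<epsilon> * measure lebesgue (dcube i)"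
    using \<epsilon> by (intro mult_right_mono) (auto simp: power_le_one mult_le_cancel_left1)
  finally obtain I where I: "disjoint_family_on dcube I" "S \<subseteq> (\<Union>l\<in>I. dcube l)"
    "\<And>l. l \<in> I \<Longrightarrow> dcube l \<subseteq> dcube i"
    "\<And>l. l \<in> I \<Longrightarrow> \<epsilon> * measure lebesgue (dcube l) < measure lebesgue (S \<inter> dcube l)"
    "\<And>l. l \<in> I \<Longrightarrow> measure lebesgue (S \<inter> dcube l) \<le> 2 ^ CARD('n) * \<epsilon> * measure lebesgue (dcube l)"
    using stopping_cubes[OF Suc.prems(1-3) \<epsilon>(1,2)] by blast
  define G where "G = (\<Union>l\<in>I. dcube l)"
  have cI: "countable I" by (rule countableI_type)
  have G: "G \<in> sets lebesgue" "G \<subseteq> dcube i" "dyadic_open G"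
  proof -
    show "G \<in> sets lebesgue" unfolding G_def
      by (rule sets.countable_UN'[OF cI]) (simp add: image_subset_iff)
    show "G \<subseteq> dcube i" unfolding G_def by (intro UN_least I(3))
    show "dyadic_open G" unfolding G_def by (intro dyadic_open_UN dyadic_open_dcube)
  qed
  then have "bounded G" using bounded_dcube[of i] bounded_subset by blast
  have S_fin: "S \<in> lmeasurable" "bounded S"
    using Suc.prems(2,3) bounded_dcube[of i] bounded_subset bounded_set_imp_lmeasurable by blast+
  have "emeasure lebesgue (\<Union>l\<in>I. dcube l) \<le> ennreal (1 / \<epsilon>) * emeasure lebesgue (\<Union>l\<in>I. S \<inter> dcube l)"
  proof (rule emeasure_UN_mono_disjoint[OF cI I(1)])
    show "disjoint_family_on (\<lambda>l. S \<inter> dcube l) I"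
      using I(1) unfolding disjoint_family_on_def by blast
    show "emeasure lebesgue (dcube l) \<le> ennreal (1 / \<epsilon>) * emeasure lebesgue (S \<inter> dcube l)" if "l \<in> I" for l
      using I(4)[OF that] \<epsilon> S_fin
      by (simp add: emeasure_eq_measure2 Suc.prems(2) ennreal_mult[symmetric] field_simps)
  qed (use Suc.prems in auto)
  moreover have S_UN: "(\<Union>l\<in>I. S \<inter> dcube l) = S" using I(2) by blast
  ultimately have "emeasure lebesgue G \<le> ennreal (1 / \<epsilon>) * emeasure lebesgue S"
    by (simp only: G_def)
  moreover have "G \<in> lmeasurable" using G \<open>bounded G\<close> by (intro bounded_set_imp_lmeasurable) auto
  ultimately have "measure lebesgue G \<le> 1 / \<epsilon> * measure lebesgue S"
    using S_fin \<epsilon> by (simp add: emeasure_eq_measure2 ennreal_mult[symmetric])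
  also have "\<dots> \<le> \<epsilon> ^ m * measure lebesgue (dcube i)"
    using \<open>measure lebesgue S \<le> \<epsilon> ^ Suc m * measure lebesgue (dcube i)\<close> \<epsilon> by (simp add: field_simps)
  finally have IH: "measure (weight_measure w) G \<le> decay_rate q K ^ m * measure (weight_measure w) (dcube i)"
    using G by (intro Suc.IH) (auto simp: \<epsilon>_def)
  have "emeasure (weight_measure w) (\<Union>l\<in>I. S \<inter> dcube l)
      \<le> ennreal (decay_rate q K) * emeasure (weight_measure w) (\<Union>l\<in>I. dcube l)"
  proof (rule emeasure_UN_mono_disjoint[OF cI _ I(1)])
    show "disjoint_family_on (\<lambda>l. S \<inter> dcube l) I"
      using I(1) unfolding disjoint_family_on_def by blast
    show "emeasure (weight_measure w) (S \<inter> dcube l)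
        \<le> ennreal (decay_rate q K) * emeasure (weight_measure w) (dcube l)" if "l \<in> I" for l
    proof -
      have "measure (weight_measure w) (S \<inter> dcube l) \<le> decay_rate q K * measure (weight_measure w) (dcube l)"
        using I(5)[OF that] Suc.prems(2) by (intro measure_weight_half_le[OF Ap w q]) (auto simp: \<epsilon>_def)
      then show ?thesis
        using rate Suc.prems(2) S_fin
        by (simp add: emeasure_eq_measure2[OF weight_fmeasurable[OF w]] bounded_Int ennreal_mult[symmetric])
    qed
  qed (use Suc.prems in auto)
  then have "emeasure (weight_measure w) S \<le> ennreal (decay_rate q K) * emeasure (weight_measure w) G"
    by (simp only: G_def S_UN)
  then have "measure (weight_measure w) S \<le> decay_rate q K * measure (weight_measure w) G"
    using rate Suc.prems(2) S_fin G \<open>bounded G\<close>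
    by (simp add: emeasure_eq_measure2[OF weight_fmeasurable[OF w]] ennreal_mult[symmetric])
  also have "\<dots> \<le> decay_rate q K * (decay_rate q K ^ m * measure (weight_measure w) (dcube i))"
    using IH rate by (intro mult_left_mono)
  finally show ?case by simp
qed

text \<open>
  The strict inequality leaves room for an open superset of slightly larger volume.
\<close>

lemma weight_decay:
  assumes Ap: "restricted_Ap q K w" and w: "weight w" and q: "0 \<le> q"
    and S: "S \<in> sets lebesgue" "S \<subseteq> dcube (i :: int \<times> (int ^ 'n))"
    "measure lebesgue S < (1 / 2 ^ (CARD('n) + 1)) ^ m * measure lebesgue (dcube i)"
  shows "measure (weight_measure w) S \<le> decay_rate q K ^ m * measure (weight_measure w) (dcube i)"
proof -
  define e where "e = (1 / 2 ^ (CARD('n) + 1)) ^ m * measure lebesgue (dcube i) - measure lebesgue S"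
  have "0 < e" using S(3) by (simp add: e_def)
  then obtain U where U: "open U" "S \<subseteq> U" "U - S \<in> lmeasurable" "emeasure lebesgue (U - S) < ennreal e"
    using sets_lebesgue_outer_open[OF S(1)] by metis
  have S_fin: "S \<in> lmeasurable"
    using S(1,2) bounded_dcube[of i] bounded_subset bounded_set_imp_lmeasurable by blast+
  have UQ: "U \<inter> dcube i \<in> sets lebesgue" using U(1) by auto
  have "measure lebesgue (U \<inter> dcube i) \<le> measure lebesgue (S \<union> (U - S))"
    using S_fin U UQ by (intro measure_mono_fmeasurable fmeasurable.Un) auto
  also have "\<dots> \<le> measure lebesgue S + measure lebesgue (U - S)"
    using S_fin U by (intro measure_Un_le) auto
  also have "measure lebesgue (U - S) < e"
    using U(3,4) \<open>0 < e\<close> by (simp add: emeasure_eq_measure2 ennreal_less_iff)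
  finally have "measure lebesgue (U \<inter> dcube i) \<le> (1 / 2 ^ (CARD('n) + 1)) ^ m * measure lebesgue (dcube i)"
    by (simp add: e_def)
  then have "measure (weight_measure w) (U \<inter> dcube i) \<le> decay_rate q K ^ m * measure (weight_measure w) (dcube i)"
    using U(1) UQ by (intro weight_decay_dyadic_open[OF Ap w q] dyadic_open_Int_open) auto
  moreover have "measure (weight_measure w) S \<le> measure (weight_measure w) (U \<inter> dcube i)"
    using S U(2) UQ by (intro measure_weight_mono[OF w]) (auto intro: bounded_Int)
  ultimately show ?thesis by linarith
qed

section \<open>Stopping cubes of the averages\<close>

text \<open>
  The data of the level set estimate, with \<open>v\<close> already multiplied by the level \<open>y\<close>. The numbers \<open>A i\<close>
  stand for the \<open>p\<close>-th power of the Lorentz norm of \<open>g\<close> restricted to the \<open>i\<close>-th cube, up to a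
  factor: they control averages and are superadditive over disjoint cubes.
\<close>

locale mixed_weights =
  fixes p r Ku Kw :: real and u v w :: "real ^ 'n \<Rightarrow> real" and g :: "real ^ 'n \<Rightarrow> ennreal"
    and A :: "int \<times> (int ^ 'n) \<Rightarrow> real" and Atot :: real
  assumes p: "1 \<le> p" and r: "1 \<le> r"
    and u: "weight u" and w: "weight w" and w_eq: "w x = u x * v x powr p"
    and v_pos: "0 < v x" and v_meas [measurable]: "v \<in> borel_measurable lebesgue"
    and Ap_u: "restricted_Ap p Ku u" and Ap_w: "restricted_Ap r Kw w"
    and g_meas [measurable]: "g \<in> borel_measurable lebesgue"
    and g_fin: "emeasure (density lebesgue g) (dcube i) < \<infinity>"
    and avg_le: "(measure (density lebesgue g) (dcube i) / measure lebesgue (dcube i)) powr p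
      * measure (weight_measure u) (dcube i) \<le> Ku * A i"
    and A_sum: "finite F \<Longrightarrow> disjoint_family_on dcube F \<Longrightarrow> (\<Sum>i\<in>F. A i) \<le> Atot"
begin

abbreviation "vol \<equiv> measure lebesgue"
abbreviation "U \<equiv> measure (weight_measure u)"
abbreviation "W \<equiv> measure (weight_measure w)"

definition mass :: "int \<times> (int ^ 'n) \<Rightarrow> real" where
  "mass i = measure (density lebesgue g) (dcube i)"

definition avg :: "int \<times> (int ^ 'n) \<Rightarrow> real" where
  "avg i = mass i / vol (dcube i)"

text \<open>
  Levels of averages are powers of \<open>2\<^bsup>n+1\<^esup>\<close>: a stopping cube of level \<open>k\<close> has an average of at most
  \<open>2\<^sup>n base\<^sup>k\<close>, which leaves a factor \<open>1/2\<close> against the next level.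
\<close>

definition base :: real where
  "base = 2 ^ (CARD('n) + 1)"

definition stops_at :: "int \<Rightarrow> int \<times> (int ^ 'n) \<Rightarrow> bool" where
  "stops_at k i \<longleftrightarrow> base powi k < avg i \<and> (\<forall>m\<ge>1. avg ((parent ^^ m) i) \<le> base powi k)"

definition stopping :: "(int \<times> (int ^ 'n)) set" where
  "stopping = {i. \<exists>k. stops_at k i}"

lemma base_gt_1: "1 < base"
proof -
  have "1 < 2 * (2 :: real) ^ CARD('n)"
    using one_le_power[of "2 :: real" "CARD('n)"] by linarith
  then show ?thesis by (simp add: base_def)
qed

lemma avg_nonneg: "0 \<le> avg i"
  by (simp add: avg_def mass_def)

lemma vol_pos [simp]: "0 < vol (dcube i)"
  by (rule measure_dcube_pos)

lemma vol_neq_0 [simp]: "vol (dcube i) \<noteq> 0"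
  using vol_pos[of i] by linarith

lemma U_pos [simp]: "0 < U (dcube i)" and W_pos [simp]: "0 < W (dcube i)"
  by (rule measure_weight_dcube_pos[OF u], rule measure_weight_dcube_pos[OF w])

lemma Ku_ge_1: "1 \<le> Ku" and Kw_ge_1: "1 \<le> Kw"
  using restricted_Ap_ge_1 Ap_u Ap_w u w by auto

lemma Atot_nonneg: "0 \<le> Atot"
  using A_sum[of "{}"] by (simp add: disjoint_family_on_def)

lemma dcube_fmeasurable_mass: "dcube i \<in> fmeasurable (density lebesgue g)"
  using g_fin by (simp add: fmeasurable_def)

lemma mass_le_sum:
  assumes "finite F" "disjoint_family_on dcube F" "\<And>j. j \<in> F \<Longrightarrow> dcube j \<subseteq> dcube i"
  shows "(\<Sum>j\<in>F. mass j) \<le> mass i"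
proof -
  have "(\<Sum>j\<in>F. mass j) = measure (density lebesgue g) (\<Union>j\<in>F. dcube j)"
    unfolding mass_def using assms(1,2) fmeasurableD2[OF dcube_fmeasurable_mass]
    by (intro measure_finite_Union[symmetric]) (auto simp: image_subset_iff)
  also have "\<dots> \<le> mass i"
    unfolding mass_def using assms(1,3)
    by (intro measure_mono_fmeasurable dcube_fmeasurable_mass) (auto intro!: sets.finite_UN)
  finally show ?thesis .
qed

lemma avg_le_parent: "avg i \<le> 2 ^ CARD('n) * avg (parent i)"
proof -
  have "mass i \<le> mass (parent i)"
    using mass_le_sum[of "{i}" "parent i"] dcube_parent[of i] by (simp add: disjoint_family_on_def)
  then show ?thesis
    by (simp add: avg_def measure_parent divide_right_mono)
qed

lemma avg_powr_le: "avg i powr p * U (dcube i) \<le> Ku * A i"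
  using avg_le by (simp add: avg_def mass_def)

lemma vol_ancestor:
  "vol (dcube ((parent ^^ m) i)) = (2 ^ CARD('n)) ^ m * vol (dcube (i :: int \<times> (int ^ 'n)))"
  by (induction m) (simp_all add: measure_parent)

text \<open>
  The weight of the ancestors of a cube tends to infinity, by the decay estimate read from the
  ancestor to the cube, while \<open>avg\<^sup>p\<close> times the weight stays bounded. Hence stopping cubes exist.
\<close>

lemma avg_ancestors_small:
  assumes "0 < c"
  obtains M where "\<And>m. M \<le> m \<Longrightarrow> avg ((parent ^^ m) i) \<le> c"
proof -
  note rate = decay_rate_bounds[of p Ku, OF _ Ku_ge_1]
  define \<theta> where "\<theta> = decay_rate p Ku"
  have \<theta>: "0 \<le> \<theta>" "\<theta> < 1" using rate p by (auto simp: \<theta>_def)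
  have "0 < c powr p * U (dcube i) / (Ku * Atot + 1)"
    using assms Ku_ge_1 Atot_nonneg by (intro divide_pos_pos mult_pos_pos add_nonneg_pos) auto
  then obtain j where j: "\<theta> ^ j < c powr p * U (dcube i) / (Ku * Atot + 1)"
    using real_arch_pow_inv \<theta>(2) by blast
  \<comment> \<open>Climbing \<open>m\<close> generations shrinks the relative volume to \<open>2\<^bsup>-nm\<^esup>\<close>, and \<open>n (2 j + 1) > (n + 1) j\<close>.\<close>
  have "avg ((parent ^^ m) i) \<le> c" if m: "2 * j + 1 \<le> m" for m
  proof -
    let ?Q = "(parent ^^ m) i"
    have "(CARD('n) + 1) * j < CARD('n) * m"
    proof -
      have "(CARD('n) + 1) * j \<le> CARD('n) * (2 * j)"
        using zero_less_card_finite[where 'a='n] by (simp add: algebra_simps)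
      also have "\<dots> < CARD('n) * m" using m by simp
      finally show ?thesis .
    qed
    then have "(2 :: real) ^ ((CARD('n) + 1) * j) < 2 ^ (CARD('n) * m)"
      by (rule power_strict_increasing) simp
    then have "vol (dcube i) < (1 / 2 ^ (CARD('n) + 1)) ^ j * vol (dcube ?Q)"
      by (simp only: vol_ancestor power_mult power_one_over) (simp add: field_simps)
    then have "U (dcube i) \<le> \<theta> ^ j * U (dcube ?Q)"
      unfolding \<theta>_def using p by (intro weight_decay[OF Ap_u u] dcube_ancestor) simp_all
    moreover have "avg ?Q powr p * U (dcube ?Q) \<le> Ku * Atot"
      using avg_powr_le[of ?Q] A_sum[of "{?Q}"] Ku_ge_1
      by (simp add: disjoint_family_on_def) (smt (verit) mult_left_mono)
    ultimately have "avg ?Q powr p * U (dcube i) \<le> \<theta> ^ j * (Ku * Atot)"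
      using \<theta> by (smt (verit) mult.assoc mult.commute mult_left_mono powr_ge_zero zero_le_power)
    also have "\<dots> \<le> \<theta> ^ j * (Ku * Atot + 1)" using \<theta> by (simp add: mult_left_mono)
    also have "\<dots> \<le> c powr p * U (dcube i)"
      using j Ku_ge_1 Atot_nonneg by (simp add: pos_less_divide_eq add_nonneg_pos less_imp_le)
    finally have "avg ?Q powr p \<le> c powr p" by simp
    then show ?thesis using p assms avg_nonneg[of ?Q] by (meson not_le powr_less_mono2 less_imp_le order.strict_trans2 zero_less_one)
  qed
  then show ?thesis using that by blast
qed

lemma ex_stops_at:
  assumes "base powi k < avg i"
  obtains m where "stops_at k ((parent ^^ m) i)"
proof -
  have "0 < base powi k" using base_gt_1 by simp
  then obtain M where M: "\<And>m. M \<le> m \<Longrightarrow> avg ((parent ^^ m) i) \<le> base powi k"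
    using avg_ancestors_small by blast
  define X where "X = {m. base powi k < avg ((parent ^^ m) i)}"
  have X: "finite X" "X \<noteq> {}"
  proof -
    have "X \<subseteq> {..<M}" using M by (force simp: X_def not_le[symmetric])
    then show "finite X" by (rule finite_subset) simp
    have "0 \<in> X" using assms by (simp add: X_def)
    then show "X \<noteq> {}" by blast
  qed
  have "avg ((parent ^^ m) ((parent ^^ Max X) i)) \<le> base powi k" if "1 \<le> m" for m
  proof (rule ccontr)
    assume "\<not> ?thesis"
    then have "m + Max X \<in> X" by (simp add: X_def funpow_add)
    then have "m + Max X \<le> Max X" using X(1) by (rule Max_ge[rotated])
    with that show False by simp
  qed
  moreover have "base powi k < avg ((parent ^^ Max X) i)"
    using Max_in[OF X] by (simp add: X_def)
  ultimately show ?thesis using that by (auto simp: stops_at_def)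
qed

lemma ancestor_if_psubset:
  assumes "dcube j \<subset> dcube i"
  obtains m where "1 \<le> m" "(parent ^^ m) j = i"
proof -
  define m where "m = nat (fst j - fst i)"
  have m: "(parent ^^ m) j = i"
    unfolding m_def using assms dcube_nonempty[of j] dcube_subset_imp_le[of j i]
    by (intro ancestor_if_meets) auto
  have "m \<noteq> 0"
  proof
    assume "m = 0"
    with m assms show False by simp
  qed
  then have "1 \<le> m" by simp
  then show ?thesis using m by (rule that)
qed

text \<open>
  A stopping cube strictly inside another one belongs to a strictly larger level, so \<open>g\<close> has an
  average above \<open>base\<^bsup>k+1\<^esup>\<close> on it; the mass available in the larger cube is at most
  \<open>2\<^sup>n base\<^sup>k\<close> times its volume.
\<close>

lemma vol_smaller_stopping:
  assumes F: "finite F" "F \<subseteq> stopping" and i: "i \<in> stopping"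
    and sub: "\<And>j. j \<in> F \<Longrightarrow> dcube j \<subset> dcube i"
  shows "vol (\<Union>j\<in>F. dcube j) \<le> vol (dcube i) / 2"
proof -
  obtain k where k: "base powi k < avg i" "\<And>m. 1 \<le> m \<Longrightarrow> avg ((parent ^^ m) i) \<le> base powi k"
    using i by (auto simp: stopping_def stops_at_def)
  let ?G = "maximal_cubes F"
  have G: "finite ?G" "?G \<subseteq> F" using F(1) maximal_cubes_subset finite_subset by blast+
  have b0: "0 < base powi (k + 1)" using base_gt_1 by simp
  have vol_le: "vol (dcube j) \<le> mass j / base powi (k + 1)" if "j \<in> F" for j
  proof -
    have "j \<in> stopping" using that F(2) by blast
    then obtain k' where k': "base powi k' < avg j" "\<And>m. 1 \<le> m \<Longrightarrow> avg ((parent ^^ m) j) \<le> base powi k'"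
      by (auto simp: stopping_def stops_at_def)
    have "dcube j \<subset> dcube i" using that by (rule sub)
    then obtain m where "1 \<le> m" "(parent ^^ m) j = i" by (rule ancestor_if_psubset)
    with k'(2)[of m] k(1) have "base powi k < base powi k'" by simp
    then have "k < k'" using base_gt_1 by (meson linorder_not_le power_int_increasing less_imp_le)
    then have "base powi (k + 1) \<le> base powi k'" using base_gt_1 by (intro power_int_increasing) auto
    with k'(1) have "base powi (k + 1) \<le> mass j / vol (dcube j)" by (simp add: avg_def)
    then show ?thesis using b0 by (simp add: field_simps pos_le_divide_eq)
  qed
  have "vol (\<Union>j\<in>F. dcube j) = vol (\<Union>j\<in>?G. dcube j)" using UN_maximal_cubes[OF F(1)] by simp
  also have "\<dots> \<le> (\<Sum>j\<in>?G. vol (dcube j))"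
    using G(1) by (intro measure_UNION_le) auto
  also have "\<dots> \<le> (\<Sum>j\<in>?G. mass j / base powi (k + 1))"
    using G(2) vol_le by (intro sum_mono) auto
  also have "\<dots> = (\<Sum>j\<in>?G. mass j) / base powi (k + 1)" by (simp add: sum_divide_distrib)
  also have "\<dots> \<le> mass i / base powi (k + 1)"
    using b0 G sub by (intro divide_right_mono mass_le_sum disjoint_maximal_cubes) auto
  also have "\<dots> = avg i * vol (dcube i) / base powi (k + 1)" 
    by (simp add: avg_def)
  also have "\<dots> \<le> (2 ^ CARD('n) * base powi k) * vol (dcube i) / base powi (k + 1)"
    using b0 avg_le_parent[of i] k(2)[of 1]
    by (intro divide_right_mono mult_right_mono) (auto intro: order_trans)
  also have "\<dots> = vol (dcube i) / 2"
  proof -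
    have "base powi (k + 1) = base powi k * (2 * 2 ^ CARD('n))"
      using base_gt_1 by (simp add: power_int_add base_def)
    then show ?thesis using base_gt_1 by (simp add: field_simps)
  qed
  finally show ?thesis .
qed

lemma W_UN_disjoint:
  assumes "finite F" "disjoint_family_on X F" "\<And>i. i \<in> F \<Longrightarrow> X i \<in> sets lebesgue" "\<And>i. i \<in> F \<Longrightarrow> bounded (X i)"
  shows "W (\<Union>i\<in>F. X i) = (\<Sum>i\<in>F. W (X i))"
  using assms emeasure_weight_finite[OF w] by (intro measure_finite_Union) (auto simp: less_top[symmetric])

text \<open>
  Every stopping cube keeps at least half of its volume after the removal of the smaller ones,
  hence a fixed fraction of its \<open>w\<close>-weight, and the remainders are disjoint.
\<close>

lemma carleson_packing:
  assumes F: "finite F" "F \<subseteq> stopping"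
  shows "(\<Sum>i\<in>F. W (dcube i)) \<le> 2 powr r * Kw * (\<Sum>i\<in>maximal_cubes F. W (dcube i))"
proof -
  define S where "S i = (\<Union>j\<in>{j\<in>F. dcube j \<subset> dcube i}. dcube j)" for i
  define E where "E i = dcube i - S i" for i
  have S_sets: "S i \<in> sets lebesgue" for i unfolding S_def using F(1) by (intro sets.finite_UN) auto
  have removed: "dcube i \<subseteq> S j" if "i \<in> F" "dcube i \<subset> dcube j" for i j
    unfolding S_def using that by (intro UN_upper) simp
  have "W (dcube i) \<le> 2 powr r * Kw * W (E i)" if "i \<in> F" for i
    unfolding E_def
  proof (rule restricted_Ap_complement[OF Ap_w w _ S_sets])
    show "S i \<subseteq> dcube i" unfolding S_def by blast
    show "vol (S i) \<le> vol (dcube i) / 2"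
      unfolding S_def using F that by (intro vol_smaller_stopping) auto
  qed (use r in simp)
  then have "(\<Sum>i\<in>F. W (dcube i)) \<le> (\<Sum>i\<in>F. 2 powr r * Kw * W (E i))" by (rule sum_mono)
  also have "\<dots> = 2 powr r * Kw * (\<Sum>i\<in>F. W (E i))" by (simp add: sum_distrib_left)
  also have "(\<Sum>i\<in>F. W (E i)) = W (\<Union>i\<in>F. E i)"
  proof (rule W_UN_disjoint[symmetric, OF F(1)])
    have "E i \<inter> E j = {}" if "i \<in> F" "j \<in> F" "i \<noteq> j" for i j
    proof -
      have "dcube i \<noteq> dcube j" using dcube_inj[of i j] that(3) by auto
      then consider "dcube i \<inter> dcube j = {}" | "dcube i \<subset> dcube j" | "dcube j \<subset> dcube i"
        using dcube_nested_or_disjoint[of i j] by (auto simp: psubset_eq)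
      then show ?thesis
      proof cases
        case 1
        then show ?thesis unfolding E_def by blast
      next
        case 2
        from removed[OF that(1) this] show ?thesis unfolding E_def by blast
      next
        case 3
        from removed[OF that(2) this] show ?thesis unfolding E_def by blast
      qed
    qed
    then show "disjoint_family_on E F" unfolding disjoint_family_on_def by blast
    show "E i \<in> sets lebesgue" for i unfolding E_def using S_sets by auto
    show "bounded (E i)" for i unfolding E_def using bounded_dcube[of i] by (rule bounded_subset) blast
  qed
  also have "W (\<Union>i\<in>F. E i) \<le> W (\<Union>i\<in>F. dcube i)"
    using F(1) S_sets by (intro measure_weight_mono[OF w]) (auto simp: E_def intro!: sets.finite_UN)
  also have "(\<Union>i\<in>F. dcube i) = (\<Union>i\<in>maximal_cubes F. dcube i)"
    using UN_maximal_cubes[OF F(1)] by simp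
  also have "W \<dots> = (\<Sum>i\<in>maximal_cubes F. W (dcube i))"
    using F(1) maximal_cubes_subset[of F] finite_subset
    by (intro W_UN_disjoint disjoint_maximal_cubes) auto
  finally show ?thesis using Kw_ge_1 by simp
qed

end

section \<open>The exceptional parts of stopping cubes\<close>

lemma ex_powi_between:
  fixes b t :: real
  assumes "1 < b" "0 < t"
  obtains k where "b powi k \<le> t" "t < b powi (k + 1)"
proof -
  define k where "k = \<lfloor>log b t\<rfloor>"
  have powi: "b powi m = b powr real_of_int m" for m
    using assms by (simp add: powr_real_of_int')
  have "b powr real_of_int k \<le> b powr log b t" "b powr log b t < b powr real_of_int (k + 1)"
    unfolding k_def using assms by (intro powr_mono powr_less_mono; linarith)+
  moreover have "b powr log b t = t" using assms by simp
  ultimately show ?thesis using that[of k] by (simp only: powi)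
qed

context mixed_weights
begin

text \<open>
  The factor \<open>6\<^sup>n\<close> pays for the passage from arbitrary to dyadic cubes, the factor \<open>base\<close> for the
  rounding of \<open>v\<close> to a level.
\<close>

definition jump :: real where
  "jump = 6 ^ CARD('n) * base"

definition exceptional :: "int \<times> (int ^ 'n) \<Rightarrow> (real ^ 'n) set" where
  "exceptional i = {x \<in> triple_cube i. v x \<le> jump * avg i}"

lemma jump_pos: "0 < jump"
  using base_gt_1 by (simp add: jump_def)

lemma exceptional_sets: "exceptional i \<in> sets lebesgue"
proof -
  have "{x \<in> space lebesgue. v x \<le> jump * avg i} \<in> sets lebesgue" by measurable
  moreover have "exceptional i = triple_cube i \<inter> {x \<in> space lebesgue. v x \<le> jump * avg i}"
    by (auto simp: exceptional_def)
  ultimately show ?thesis by auto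
qed

lemma exceptional_triple: "exceptional i \<subseteq> triple_cube i"
  by (auto simp: exceptional_def)

lemma bounded_exceptional: "bounded (exceptional i)"
  using bounded_triple_cube exceptional_triple by (rule bounded_subset)

lemma emeasure_mass: "emeasure (density lebesgue g) (dcube i) = ennreal (mass i)"
  unfolding mass_def by (rule emeasure_eq_measure2[OF dcube_fmeasurable_mass])

text \<open>
  A cube of side \<open>h\<close> through \<open>x\<close> is covered by the \<open>3\<^sup>n\<close> neighbours of a dyadic cube around \<open>x\<close> whose side
  lies between \<open>h\<close> and \<open>2 h\<close>. One of the neighbours carries at least the fraction \<open>3\<^sup>-\<^sup>n\<close> of the
  integral, and its volume is at most \<open>(2 h)\<^sup>n\<close>.
\<close>

lemma cube_average_le_neighbour:
  assumes h: "0 < h" and x: "x \<in> cbox b (b + (\<chi> i. h))"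
    and less: "ennreal t < (\<integral>\<^sup>+z\<in>cbox b (b + (\<chi> i. h)). g z \<partial>lebesgue) / emeasure lebesgue (cbox b (b + (\<chi> i. h)))"
    and t: "0 < t"
  obtains l where "x \<in> triple_cube l" "t < 6 ^ CARD('n) * avg l"
proof -
  let ?R = "cbox b (b + (\<chi> i. h))"
  obtain k where k: "2 powi k \<le> h" "h < 2 powi (k + 1)"
    using ex_powi_between[of 2 h] h by auto
  define s where "s = - (k + 1)"
  have side: "h \<le> 2 powi - s" "2 powi - s \<le> 2 * h"
    using k by (auto simp: s_def power_int_add)
  define i where "i = dindex s x"
  have R_sub: "?R \<subseteq> triple_cube i"
  proof
    fix z assume z: "z \<in> ?R"
    have "\<bar>\<lfloor>z $ j * 2 powi s\<rfloor> - \<lfloor>x $ j * 2 powi s\<rfloor>\<bar> \<le> 1" for j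
    proof -
      have "b $ j \<le> z $ j \<and> z $ j \<le> b $ j + h" "b $ j \<le> x $ j \<and> x $ j \<le> b $ j + h"
        using z x by (auto simp: mem_box_cart)
      then have "\<bar>z $ j - x $ j\<bar> \<le> 2 powi - s" using side(1) by linarith
      then have "\<bar>z $ j - x $ j\<bar> * 2 powi s \<le> 1"
        by (simp add: power_int_minus field_simps)
      then have "\<bar>z $ j * 2 powi s - x $ j * 2 powi s\<bar> \<le> 1"
        by (simp add: left_diff_distrib[symmetric] abs_mult)
      then show ?thesis by linarith
    qed
    then show "z \<in> triple_cube i" by (simp add: triple_cube_def i_def dindex_def)
  qed
  have "emeasure lebesgue ?R = ennreal (h ^ CARD('n))"
  proof -
    have "measure lebesgue ?R = h ^ CARD('n)"
      using h by (auto simp: content_cbox_if_cart interval_eq_empty_cart not_less)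
    then show ?thesis by (simp only: emeasure_eq_measure2[OF lmeasurable_cbox])
  qed
  moreover have "(\<integral>\<^sup>+z\<in>?R. g z \<partial>lebesgue) = emeasure (density lebesgue g) ?R"
    by (rule emeasure_density[symmetric]) auto
  moreover have "emeasure (density lebesgue g) ?R \<le> ennreal (\<Sum>l\<in>neighbours i. mass l)"
  proof -
    have "emeasure (density lebesgue g) ?R \<le> emeasure (density lebesgue g) (\<Union>l\<in>neighbours i. dcube l)"
      using R_sub finite_neighbours[of i]
      by (intro emeasure_mono) (auto simp: triple_cube_UN[symmetric])
    also have "\<dots> \<le> (\<Sum>l\<in>neighbours i. emeasure (density lebesgue g) (dcube l))"
      using finite_neighbours[of i] by (intro emeasure_subadditive_finite) (auto simp: image_subset_iff)
    also have "\<dots> = ennreal (\<Sum>l\<in>neighbours i. mass l)"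
      by (simp add: emeasure_mass sum_ennreal mass_def)
    finally show ?thesis .
  qed
  ultimately have "ennreal t < ennreal (\<Sum>l\<in>neighbours i. mass l) / ennreal (h ^ CARD('n))"
    using less by (metis divide_right_mono_ennreal order_less_le_trans)
  then have "t * h ^ CARD('n) < (\<Sum>l\<in>neighbours i. mass l)"
    using h t by (simp add: divide_ennreal sum_nonneg mass_def ennreal_less_iff field_simps)
  moreover have "(\<Sum>l\<in>neighbours i. mass l) \<le> card (neighbours i) * (t * h ^ CARD('n) / 3 ^ CARD('n))"
    if "\<And>l. l \<in> neighbours i \<Longrightarrow> mass l \<le> t * h ^ CARD('n) / 3 ^ CARD('n)"
    by (rule sum_bounded_above[OF that])
  ultimately obtain l where l: "l \<in> neighbours i" "t * h ^ CARD('n) / 3 ^ CARD('n) < mass l"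
    unfolding card_neighbours by (auto simp: not_le[symmetric])
  have "fst l = s" using l(1) by (simp add: neighbours_def i_def)
  then have vol_l: "vol (dcube l) \<le> (2 * h) ^ CARD('n)"
    unfolding measure_dcube using side(2) by (intro power_mono) auto
  have "(6 :: real) ^ CARD('n) = 3 ^ CARD('n) * 2 ^ CARD('n)"
    by (simp flip: power_mult_distrib)
  then have "t = 6 ^ CARD('n) * (t * h ^ CARD('n) / 3 ^ CARD('n) / (2 * h) ^ CARD('n))"
    using h by (simp add: power_mult_distrib)
  also have "\<dots> < 6 ^ CARD('n) * (mass l / (2 * h) ^ CARD('n))"
    using l(2) h by (intro mult_strict_left_mono divide_strict_right_mono) auto
  also have "\<dots> \<le> 6 ^ CARD('n) * avg l"
    unfolding avg_def using vol_l by (intro mult_left_mono divide_left_mono) (auto simp: mass_def h)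
  finally have "t < 6 ^ CARD('n) * avg l" .
  moreover have "x \<in> triple_cube l"
  proof -
    have "\<bar>\<lfloor>x $ j * 2 powi s\<rfloor> - snd l $ j\<bar> \<le> 1" for j
      using l(1) by (simp add: neighbours_def i_def dindex_def abs_minus_commute)
    then show ?thesis by (simp add: triple_cube_def \<open>fst l = s\<close>)
  qed
  ultimately show ?thesis using that by blast
qed

text \<open>
  At a point of the set, round \<open>v x / 6\<^sup>n\<close> down to a power of \<open>base\<close> and climb from the neighbour with
  large average to the last ancestor whose average exceeds that power.
\<close>

lemma superlevel_set_subset: "{x. ennreal (v x) < maximal_op g x} \<subseteq> (\<Union>i\<in>stopping. exceptional i)"
proof
  fix x assume "x \<in> {x. ennreal (v x) < maximal_op g x}"
  then obtain R where R: "R \<in> cubes" "x \<in> R"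
    "ennreal (v x) < (\<integral>\<^sup>+z\<in>R. g z \<partial>lebesgue) / emeasure lebesgue R"
    by (auto simp: maximal_op_def less_SUP_iff)
  then obtain b h where bh: "0 < h" "R = cbox b (b + (\<chi> i. h))" by (auto simp: cubes_def)
  obtain l where l: "x \<in> triple_cube l" "v x < 6 ^ CARD('n) * avg l"
    using cube_average_le_neighbour[of h x b "v x"] R bh v_pos by blast
  obtain k where k: "base powi k \<le> v x / 6 ^ CARD('n)" "v x / 6 ^ CARD('n) < base powi (k + 1)"
    using ex_powi_between[of base "v x / 6 ^ CARD('n)"] base_gt_1 v_pos[of x] by auto
  have "6 ^ CARD('n) * base powi k \<le> v x" using k(1) by (simp add: field_simps)
  with l(2) have "6 ^ CARD('n) * base powi k < 6 ^ CARD('n) * avg l" by linarith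
  then have "base powi k < avg l" by simp
  then obtain m where m: "stops_at k ((parent ^^ m) l)" by (rule ex_stops_at)
  define i where "i = (parent ^^ m) l"
  have "x \<in> triple_cube i" using l(1) triple_ancestor[of l m] by (auto simp: i_def)
  moreover have "v x \<le> jump * avg i"
  proof -
    have "v x \<le> jump * base powi k"
      using k(2) base_gt_1 by (simp add: jump_def power_int_add field_simps)
    also have "\<dots> \<le> jump * avg i"
      using m jump_pos by (auto simp: stops_at_def i_def)
    finally show ?thesis .
  qed
  ultimately have "x \<in> exceptional i" by (simp add: exceptional_def)
  moreover have "i \<in> stopping" using m by (auto simp: stopping_def i_def)
  ultimately show "x \<in> (\<Union>i\<in>stopping. exceptional i)" by blast
qed

lemma W_le_U:
  assumes "S \<in> sets lebesgue" "bounded S" "\<And>x. x \<in> S \<Longrightarrow> v x \<le> c" "0 \<le> c"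
  shows "W S \<le> c powr p * U S"
proof -
  have "emeasure (weight_measure w) S \<le> (\<integral>\<^sup>+x\<in>S. ennreal (c powr p) * ennreal (u x) \<partial>lebesgue)"
    unfolding emeasure_weight[OF w assms(1)]
  proof (intro nn_integral_mono)
    fix x
    have "w x \<le> c powr p * u x" if "x \<in> S"
      unfolding w_eq using assms(3)[OF that] v_pos[of x] weight_pos[OF u, of x] p
      by (simp add: mult.commute mult_right_mono powr_mono2)
    then show "ennreal (w x) * indicator S x \<le> ennreal (c powr p) * ennreal (u x) * indicator S x"
      using weight_pos[OF u, of x] by (auto simp: indicator_def ennreal_mult[symmetric] intro!: ennreal_leI)
  qed
  also have "\<dots> = ennreal (c powr p) * emeasure (weight_measure u) S"
    unfolding emeasure_weight[OF u assms(1)] mult.assoc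
    using weight_measurable[OF u] assms(1) by (intro nn_integral_cmult) auto
  finally show ?thesis
    using assms(1,2) by (simp add: emeasure_eq_measure2[OF weight_fmeasurable[OF w]]
        emeasure_eq_measure2[OF weight_fmeasurable[OF u]] ennreal_mult[symmetric])
qed

text \<open>
  The size of \<open>g\<close> on a cube relative to its \<open>w\<close>-weight. Since \<open>v\<^sup>p\<close> is the density of \<open>w\<close> with respect
  to \<open>u\<close>, a small ratio means that \<open>v\<close> is small on the exceptional part compared with its typical
  size on the cube.
\<close>

definition ratio :: "int \<times> (int ^ 'n) \<Rightarrow> real" where
  "ratio i = avg i powr p * U (dcube i) / W (dcube i)"

text \<open>
  Cubes above the threshold are paid for directly. The value is the one for which the
  inequality in \<open>U_exceptional_decay\<close> becomes strict, with the factor \<open>1/2\<close> to spare.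
\<close>

definition threshold :: real where
  "threshold = 1 / (2 * Kw * (jump powr p * Ku * (3 ^ CARD('n)) powr p) * (3 ^ CARD('n)) powr r)"

abbreviation "rate \<equiv> decay_rate p Ku"

lemma rate_bounds: "0 \<le> rate" "rate < 1"
  using decay_rate_bounds[of p Ku] p Ku_ge_1 by auto

lemma threshold_pos: "0 < threshold"
  using Kw_ge_1 Ku_ge_1 jump_pos by (simp add: threshold_def)

lemma ratio_W: "ratio i * W (dcube i) = avg i powr p * U (dcube i)"
  using less_imp_neq[OF W_pos[of i]] by (simp add: ratio_def)

lemma ratio_nonneg: "0 \<le> ratio i"
  by (simp add: ratio_def)

lemma ratio_pos:
  assumes "i \<in> stopping" shows "0 < ratio i"
proof -
  obtain k where "base powi k < avg i" using assms by (auto simp: stopping_def stops_at_def)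
  moreover have "0 < base powi k" using base_gt_1 by simp
  ultimately show ?thesis by (simp add: ratio_def)
qed

lemma W_exceptional_le_U: "W (exceptional i) \<le> jump powr p * avg i powr p * U (exceptional i)"
proof -
  have "W (exceptional i) \<le> (jump * avg i) powr p * U (exceptional i)"
    using exceptional_sets bounded_exceptional jump_pos avg_nonneg[of i]
    by (intro W_le_U) (auto simp: exceptional_def)
  then show ?thesis using jump_pos avg_nonneg[of i] by (simp add: powr_mult)
qed

lemma W_exceptional_le:
  assumes "U (exceptional i) \<le> c * U (triple_cube i)" "0 \<le> c"
  shows "W (exceptional i) \<le> jump powr p * Ku * (3 ^ CARD('n)) powr p * c * ratio i * W (dcube i)"
proof -
  have "U (exceptional i) \<le> c * (Ku * (3 ^ CARD('n)) powr p * U (dcube i))"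
    using assms measure_weight_triple_le[OF Ap_u, of i] by (meson mult_left_mono order_trans)
  then have "jump powr p * avg i powr p * U (exceptional i)
      \<le> jump powr p * avg i powr p * (c * (Ku * (3 ^ CARD('n)) powr p * U (dcube i)))"
    by (intro mult_left_mono) auto
  also have "\<dots> = jump powr p * Ku * (3 ^ CARD('n)) powr p * c * (avg i powr p * U (dcube i))"
    by (simp add: mult_ac)
  finally show ?thesis using W_exceptional_le_U[of i] by (simp add: ratio_W[symmetric] mult.assoc)
qed

text \<open>
  On the exceptional part \<open>v \<le> jump * avg\<close>, so its \<open>w\<close>-weight is at most a multiple of
  \<open>ratio * w(Q)\<close>. The restricted inequality for \<open>w\<close> turns this into small volume, and the decay
  estimate for \<open>u\<close> into small \<open>u\<close>-weight. The decay estimate concerns dyadic cubes, so it is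
  applied to each neighbour separately.
\<close>

lemma U_exceptional_decay:
  assumes "ratio i * (base powr r) ^ m \<le> threshold"
  shows "U (exceptional i) \<le> rate ^ m * U (triple_cube i)"
proof -
  let ?T = "exceptional i" and ?Q = "dcube i" and ?C = "jump powr p * Ku * (3 ^ CARD('n)) powr p"
  have C_pos: "0 < ?C" using jump_pos Ku_ge_1 by simp
  have "U ?T \<le> 1 * U (triple_cube i)"
    using measure_weight_mono[OF u _ _ exceptional_triple exceptional_sets] by simp
  from W_exceptional_le[OF this] have WT: "W ?T \<le> ?C * ratio i * W ?Q" by simp
  have "W (triple_cube i) * vol ?T powr r \<le> Kw * vol (triple_cube i) powr r * W ?T"
    by (rule restricted_Ap_triple[OF Ap_w exceptional_sets exceptional_triple])
  also have "\<dots> \<le> Kw * vol (triple_cube i) powr r * (?C * ratio i * W ?Q)"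
    using Kw_ge_1 WT by (intro mult_left_mono) auto
  also have "\<dots> \<le> Kw * vol (triple_cube i) powr r * (?C * ratio i * W (triple_cube i))"
    using Kw_ge_1 C_pos ratio_nonneg[of i] measure_weight_mono[OF w _ _ dcube_triple, of i]
    by (intro mult_left_mono) auto
  also have "\<dots> \<le> W (triple_cube i) * (Kw * ?C * (3 ^ CARD('n)) powr r * ratio i * vol ?Q powr r)"
    by (simp add: measure_triple powr_mult mult_ac)
  finally have "W (triple_cube i) * vol ?T powr r
      \<le> W (triple_cube i) * (Kw * ?C * (3 ^ CARD('n)) powr r * ratio i * vol ?Q powr r)" .
  moreover have "0 < W (triple_cube i)"
    using measure_weight_mono[OF w _ _ dcube_triple, of i] by (intro less_le_trans[OF W_pos[of i]]) simp
  ultimately have "vol ?T powr r \<le> Kw * ?C * (3 ^ CARD('n)) powr r * ratio i * vol ?Q powr r" by simp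
  also have "Kw * ?C * (3 ^ CARD('n)) powr r * ratio i * (base powr r) ^ m < 1"
  proof -
    have c: "0 < Kw * ?C * (3 ^ CARD('n)) powr r" using C_pos Kw_ge_1 by simp
    have "Kw * ?C * (3 ^ CARD('n)) powr r * (ratio i * (base powr r) ^ m) \<le> Kw * ?C * (3 ^ CARD('n)) powr r * threshold"
      using c assms by (intro mult_left_mono) auto
    also have "\<dots> = 1 / 2"
      using jump_pos Ku_ge_1 Kw_ge_1 by (simp add: threshold_def)
    finally show ?thesis by (simp add: mult.assoc)
  qed
  then have "Kw * ?C * (3 ^ CARD('n)) powr r * ratio i * vol ?Q powr r < ((1 / base) ^ m * vol ?Q) powr r"
  proof -
    have "((1 / base) ^ m * vol ?Q) powr r = vol ?Q powr r / (base powr r) ^ m"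
      using base_gt_1 by (simp add: powr_mult power_one_over powr_divide powr_realpow[symmetric] powr_powr mult.commute)
    then show ?thesis
      using \<open>Kw * ?C * (3 ^ CARD('n)) powr r * ratio i * (base powr r) ^ m < 1\<close> base_gt_1 vol_pos[of i]
      by (simp add: pos_less_divide_eq mult.commute[of _ "vol ?Q powr r"] mult.assoc)
  qed
  finally have powr_less: "vol ?T powr r < ((1 / base) ^ m * vol ?Q) powr r" .
  have vol_T: "vol ?T < (1 / base) ^ m * vol ?Q"
  proof (rule ccontr)
    assume "\<not> ?thesis"
    then have "((1 / base) ^ m * vol ?Q) powr r \<le> vol ?T powr r"
      using r base_gt_1 by (intro powr_mono2) auto
    with powr_less show False by simp
  qed
  have T_UN: "?T = (\<Union>l\<in>neighbours i. ?T \<inter> dcube l)"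
    using exceptional_triple[of i] by (auto simp only: triple_cube_UN)
  have bd: "bounded (?T \<inter> dcube l)" for l using bounded_dcube by (simp add: bounded_Int)
  have "U ?T \<le> (\<Sum>l\<in>neighbours i. U (?T \<inter> dcube l))"
    using exceptional_sets emeasure_weight_finite[OF u bd]
    by (subst T_UN, intro measure_UNION_le finite_neighbours) auto
  also have "\<dots> \<le> (\<Sum>l\<in>neighbours i. rate ^ m * U (dcube l))"
  proof (rule sum_mono)
    fix l assume "l \<in> neighbours i"
    then have "vol (dcube l) = vol ?Q" by (simp add: measure_dcube neighbours_def)
    moreover have "vol (?T \<inter> dcube l) \<le> vol ?T"
      using exceptional_sets bounded_exceptional
      by (intro measure_mono_fmeasurable bounded_set_imp_lmeasurable) auto
    ultimately show "U (?T \<inter> dcube l) \<le> rate ^ m * U (dcube l)"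
      using vol_T exceptional_sets p by (intro weight_decay[OF Ap_u u]) (auto simp: base_def)
  qed
  also have "\<dots> = rate ^ m * U (triple_cube i)"
  proof -
    have "U (triple_cube i) = (\<Sum>l\<in>neighbours i. U (dcube l))"
      unfolding triple_cube_UN using emeasure_weight_finite[OF u bounded_dcube]
      by (intro measure_finite_Union finite_neighbours disjoint_same_scale[of _ "fst i"])
        (auto simp: neighbours_def image_subset_iff less_top[symmetric])
    then show ?thesis by (simp add: sum_distrib_left)
  qed
  finally show ?thesis .
qed

end

section \<open>The level set estimate\<close>

text \<open>
  The common factor comes from \<open>jump\<^sup>p\<close> and the doubling of \<open>u\<close>. The first summand is the
  contribution of the cubes above the threshold, the second that of all levels below it.
\<close>

definition weak_type_const :: "real \<Rightarrow> real \<Rightarrow> nat \<Rightarrow> real" where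
  "weak_type_const p r d = (6 ^ d * 2 ^ (d + 1)) powr p * (3 ^ d) powr p *
    (2 * ((3 ^ d) powr r)\<^sup>2 + (2 ^ (d + 1)) powr r * 2 powr r * 2 powr p)"

context mixed_weights
begin

text \<open>
  Threefold cubes of nested cubes are nested, so those of the maximal cubes cover all exceptional
  parts, and on a maximal cube a large ratio bounds \<open>w(Q)\<close> by \<open>A(Q)\<close>.
\<close>

lemma W_heavy:
  assumes F: "finite F" "\<And>i. i \<in> F \<Longrightarrow> threshold \<le> ratio i"
  shows "W (\<Union>i\<in>F. exceptional i) \<le> Kw * (3 ^ CARD('n)) powr r * Ku * Atot / threshold"
proof -
  let ?G = "maximal_cubes F"
  have G: "finite ?G" "?G \<subseteq> F" using F(1) maximal_cubes_subset finite_subset by blast+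
  have sub: "(\<Union>i\<in>F. exceptional i) \<subseteq> (\<Union>i\<in>?G. triple_cube i)"
  proof (rule UN_least)
    fix i assume "i \<in> F"
    with F(1) obtain j where j: "j \<in> ?G" "dcube i \<subseteq> dcube j" using ex_maximal_cube by blast
    have "(parent ^^ nat (fst i - fst j)) i = j"
      using j(2) dcube_nonempty[of i] dcube_subset_imp_le[OF j(2)] by (intro ancestor_if_meets) auto
    then have "triple_cube i \<subseteq> triple_cube j" using triple_ancestor by metis
    with exceptional_triple[of i] j(1) show "exceptional i \<subseteq> (\<Union>i\<in>?G. triple_cube i)" by blast
  qed
  have "W (\<Union>i\<in>F. exceptional i) \<le> W (\<Union>i\<in>?G. triple_cube i)"
  proof (rule measure_weight_mono[OF w _ _ sub])
    show "bounded (\<Union>i\<in>?G. triple_cube i)" by (rule bounded_UN[OF G(1)]) simp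
    show "(\<Union>i\<in>?G. triple_cube i) \<in> sets lebesgue" by (rule sets.finite_UN[OF G(1)]) simp
    show "(\<Union>i\<in>F. exceptional i) \<in> sets lebesgue" by (rule sets.finite_UN[OF F(1) exceptional_sets])
  qed
  also have "\<dots> \<le> (\<Sum>i\<in>?G. W (triple_cube i))"
    using emeasure_weight_finite[OF w bounded_triple_cube] G(1)
    by (intro measure_UNION_le) auto
  also have "\<dots> \<le> (\<Sum>i\<in>?G. Kw * (3 ^ CARD('n)) powr r * (Ku * A i / threshold))"
  proof (rule sum_mono)
    fix i assume "i \<in> ?G"
    then have "threshold \<le> ratio i" using F(2) G(2) by blast
    then have "threshold * W (dcube i) \<le> ratio i * W (dcube i)" by (rule mult_right_mono) simp
    also have "\<dots> \<le> Ku * A i" unfolding ratio_W by (rule avg_powr_le)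
    finally have "W (dcube i) \<le> Ku * A i / threshold"
      using threshold_pos by (simp add: field_simps)
    then have "Kw * (3 ^ CARD('n)) powr r * W (dcube i) \<le> Kw * (3 ^ CARD('n)) powr r * (Ku * A i / threshold)"
      using Kw_ge_1 by (intro mult_left_mono) auto
    with measure_weight_triple_le[OF Ap_w, of i]
    show "W (triple_cube i) \<le> Kw * (3 ^ CARD('n)) powr r * (Ku * A i / threshold)" by linarith
  qed
  also have "\<dots> = Kw * (3 ^ CARD('n)) powr r * Ku / threshold * (\<Sum>i\<in>?G. A i)"
    by (simp add: sum_distrib_left mult.assoc)
  also have "\<dots> \<le> Kw * (3 ^ CARD('n)) powr r * Ku / threshold * Atot"
    using G(1) Kw_ge_1 Ku_ge_1 threshold_pos
    by (intro mult_left_mono A_sum disjoint_maximal_cubes) auto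
  finally show ?thesis by simp
qed

definition light_const :: real where
  "light_const = jump powr p * Ku * (3 ^ CARD('n)) powr p * base powr r * (2 powr r * Kw) * Ku * Atot"

lemma light_const_nonneg: "0 \<le> light_const"
  using Ku_ge_1 Kw_ge_1 Atot_nonneg by (simp add: light_const_def)

text \<open>
  The exceptional parts gain \<open>rate\<^sup>m\<close> over \<open>ratio * w(Q)\<close>. Within one level the ratio is essentially
  constant, so the packing estimate replaces the sum of \<open>w(Q)\<close> by the sum over maximal cubes,
  where \<open>w(Q)\<close> is converted back into \<open>A\<close>.
\<close>

lemma W_light_level:
  assumes F: "finite F" "F \<subseteq> stopping"
    and level: "\<And>i. i \<in> F \<Longrightarrow> ratio i * (base powr r) ^ m \<le> threshold"
      "\<And>i. i \<in> F \<Longrightarrow> threshold < ratio i * (base powr r) ^ Suc m"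
  shows "W (\<Union>i\<in>F. exceptional i) \<le> light_const * rate ^ m"
proof -
  let ?G = "maximal_cubes F" and ?C = "jump powr p * Ku * (3 ^ CARD('n)) powr p"
  have G: "finite ?G" "?G \<subseteq> F" using F(1) maximal_cubes_subset finite_subset by blast+
  define b where "b = base powr r"
  have b: "0 < b" using base_gt_1 by (simp add: b_def)
  have C: "0 \<le> ?C" using Ku_ge_1 by simp
  have "W (\<Union>i\<in>F. exceptional i) \<le> (\<Sum>i\<in>F. W (exceptional i))"
    using emeasure_weight_finite[OF w bounded_exceptional] exceptional_sets F(1)
    by (intro measure_UNION_le) auto
  also have "\<dots> \<le> (\<Sum>i\<in>F. ?C * rate ^ m * (threshold / b ^ m) * W (dcube i))"
  proof (rule sum_mono)
    fix i assume "i \<in> F"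
    have "W (exceptional i) \<le> ?C * rate ^ m * ratio i * W (dcube i)"
      using U_exceptional_decay[OF level(1)[OF \<open>i \<in> F\<close>]] rate_bounds by (intro W_exceptional_le) auto
    also have "\<dots> \<le> ?C * rate ^ m * (threshold / b ^ m) * W (dcube i)"
      using level(1)[OF \<open>i \<in> F\<close>] C rate_bounds b
      by (intro mult_right_mono mult_left_mono) (auto simp: b_def[symmetric] pos_le_divide_eq)
    finally show "W (exceptional i) \<le> ?C * rate ^ m * (threshold / b ^ m) * W (dcube i)" .
  qed
  also have "\<dots> = ?C * rate ^ m * (threshold / b ^ m) * (\<Sum>i\<in>F. W (dcube i))"
    by (simp add: sum_distrib_left)
  also have "\<dots> \<le> ?C * rate ^ m * (threshold / b ^ m) * (2 powr r * Kw * (\<Sum>i\<in>?G. W (dcube i)))"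
    using C rate_bounds b threshold_pos by (intro mult_left_mono carleson_packing[OF F]) auto
  also have "\<dots> \<le> ?C * rate ^ m * (threshold / b ^ m) * (2 powr r * Kw * (\<Sum>i\<in>?G. b ^ Suc m / threshold * Ku * A i))"
  proof (intro mult_left_mono sum_mono)
    fix i assume "i \<in> ?G"
    then have "i \<in> F" using G(2) by blast
    then have "threshold \<le> ratio i * b ^ Suc m"
      using level(2)[of i] by (simp add: b_def)
    then have "threshold * W (dcube i) \<le> (ratio i * b ^ Suc m) * W (dcube i)" by (rule mult_right_mono) simp
    also have "\<dots> = b ^ Suc m * (ratio i * W (dcube i))" by (simp only: mult_ac)
    also have "\<dots> \<le> b ^ Suc m * (Ku * A i)"
      unfolding ratio_W using b by (intro mult_left_mono avg_powr_le) auto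
    finally show "W (dcube i) \<le> b ^ Suc m / threshold * Ku * A i"
      using threshold_pos by (simp add: field_simps)
  qed (use C rate_bounds b threshold_pos Kw_ge_1 in auto)
  also have "\<dots> = ?C * rate ^ m * b * (2 powr r * Kw) * Ku * (\<Sum>i\<in>?G. A i)"
    using b threshold_pos by (simp only: sum_distrib_left[symmetric]) (simp add: field_simps)
  also have "\<dots> \<le> ?C * rate ^ m * b * (2 powr r * Kw) * Ku * Atot"
    using C rate_bounds b Kw_ge_1 Ku_ge_1 G(1)
    by (intro mult_left_mono A_sum disjoint_maximal_cubes) auto
  finally show ?thesis by (simp add: light_const_def b_def mult_ac)
qed

lemma W_light:
  assumes F: "finite F" "F \<subseteq> stopping" "\<And>i. i \<in> F \<Longrightarrow> ratio i < threshold"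
  shows "W (\<Union>i\<in>F. exceptional i) \<le> light_const * (2 powr p * Ku)"
proof -
  define b where "b = base powr r"
  have b: "1 < b" using base_gt_1 r by (simp add: b_def)
  have "\<exists>m. ratio i * b ^ m \<le> threshold \<and> threshold < ratio i * b ^ Suc m" if "i \<in> F" for i
  proof -
    have "i \<in> stopping" using F(2) that by blast
    then have i: "0 < ratio i" "ratio i < threshold" using ratio_pos[of i] F(3)[OF that] by simp_all
    obtain k where k: "b powi k \<le> threshold / ratio i" "threshold / ratio i < b powi (k + 1)"
      using ex_powi_between[OF b, of "threshold / ratio i"] i threshold_pos by auto
    have "0 \<le> k"
    proof (rule ccontr)
      assume "\<not> 0 \<le> k"
      then have "b powi (k + 1) \<le> b powi 0" using b by (intro power_int_increasing) auto
      moreover have "1 < threshold / ratio i" using i by simp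
      ultimately show False using k(2) by simp
    qed
    then have "b powi k = b ^ nat k" "b powi (k + 1) = b ^ Suc (nat k)"
      using b by (auto simp: power_int_def nat_add_distrib)
    with k i show ?thesis by (intro exI[of _ "nat k"]) (simp add: field_simps)
  qed
  then obtain lev where lev: "\<And>i. i \<in> F \<Longrightarrow> ratio i * b ^ lev i \<le> threshold"
    "\<And>i. i \<in> F \<Longrightarrow> threshold < ratio i * b ^ Suc (lev i)" by metis
  have fin: "finite (lev ` F)" using F(1) by simp
  have "(\<Union>i\<in>F. exceptional i) = (\<Union>m\<in>lev ` F. \<Union>i\<in>{i\<in>F. lev i = m}. exceptional i)" by blast
  also have "W \<dots> \<le> (\<Sum>m\<in>lev ` F. W (\<Union>i\<in>{i\<in>F. lev i = m}. exceptional i))"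
  proof (rule measure_UNION_le[OF fin])
    show "(\<Union>i\<in>{i\<in>F. lev i = m}. exceptional i) \<in> sets (weight_measure w)" for m
      using F(1) exceptional_sets by (intro sets.finite_UN) auto
  qed
  also have "\<dots> \<le> (\<Sum>m\<in>lev ` F. light_const * rate ^ m)"
    using F lev by (intro sum_mono W_light_level) (auto simp: b_def)
  also have "\<dots> = light_const * (\<Sum>m\<in>lev ` F. rate ^ m)" by (simp add: sum_distrib_left)
  also have "\<dots> \<le> light_const * (\<Sum>m. rate ^ m)"
    using rate_bounds light_const_nonneg fin
    by (intro mult_left_mono sum_le_suminf) auto
  also have "(\<Sum>m. rate ^ m) = 2 powr p * Ku"
    using rate_bounds by (simp add: suminf_geometric decay_rate_def)
  finally show ?thesis .
qed

lemma W_finite_stopping: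
  assumes F: "finite F" "F \<subseteq> stopping"
  shows "W (\<Union>i\<in>F. exceptional i) \<le> weak_type_const p r CARD('n) * Ku ^ 3 * Kw\<^sup>2 * Atot"
proof -
  let ?H = "{i\<in>F. threshold \<le> ratio i}" and ?L = "{i\<in>F. ratio i < threshold}"
  have "?H \<union> ?L = F" by auto
  then have UN_eq: "(\<Union>i\<in>F. exceptional i) = (\<Union>i\<in>?H. exceptional i) \<union> (\<Union>i\<in>?L. exceptional i)"
    by (simp flip: UN_Un)
  have split: "W (\<Union>i\<in>F. exceptional i) \<le> W (\<Union>i\<in>?H. exceptional i) + W (\<Union>i\<in>?L. exceptional i)"
    unfolding UN_eq using F(1) exceptional_sets
    by (intro measure_Un_le) (auto intro!: sets.finite_UN)
  define c where "c = jump powr p * (3 ^ CARD('n)) powr p"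
  define B where "B = Ku ^ 3 * Kw\<^sup>2 * Atot"
  have c: "0 \<le> c" by (simp add: c_def)
  have "W (\<Union>i\<in>?H. exceptional i) \<le> Kw * (3 ^ CARD('n)) powr r * Ku * Atot / threshold"
    by (rule W_heavy) (simp_all add: F(1))
  also have "\<dots> = c * (2 * ((3 ^ CARD('n)) powr r)\<^sup>2) * (Ku\<^sup>2 * Kw\<^sup>2 * Atot)"
    by (simp add: threshold_def c_def power2_eq_square mult_ac)
  also have "\<dots> \<le> c * (2 * ((3 ^ CARD('n)) powr r)\<^sup>2) * B"
    unfolding B_def using Ku_ge_1 Atot_nonneg c
    by (intro mult_left_mono mult_right_mono power_increasing) auto
  finally have heavy: "W (\<Union>i\<in>?H. exceptional i) \<le> c * (2 * ((3 ^ CARD('n)) powr r)\<^sup>2) * B" .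
  have "W (\<Union>i\<in>?L. exceptional i) \<le> light_const * (2 powr p * Ku)"
  proof (rule W_light)
    show "?L \<subseteq> stopping" using F(2) by blast
  qed (simp_all add: F(1))
  also have "\<dots> = c * (base powr r * 2 powr r * 2 powr p) * (Ku ^ 3 * Kw * Atot)"
    by (simp add: light_const_def c_def power3_eq_cube mult_ac)
  also have "\<dots> \<le> c * (base powr r * 2 powr r * 2 powr p) * B"
    unfolding B_def using Ku_ge_1 Kw_ge_1 Atot_nonneg c
    by (intro mult_left_mono mult_right_mono) (auto simp: power2_eq_square)
  finally have light: "W (\<Union>i\<in>?L. exceptional i) \<le> c * (base powr r * 2 powr r * 2 powr p) * B" .
  have "weak_type_const p r CARD('n) * Ku ^ 3 * Kw\<^sup>2 * Atot
      = c * (2 * ((3 ^ CARD('n)) powr r)\<^sup>2) * B + c * (base powr r * 2 powr r * 2 powr p) * B"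
  proof -
    have "weak_type_const p r CARD('n) = jump powr p * (3 ^ CARD('n)) powr p *
        (2 * ((3 ^ CARD('n)) powr r)\<^sup>2 + base powr r * 2 powr r * 2 powr p)"
      by (simp only: weak_type_const_def jump_def base_def)
    then show ?thesis by (simp add: c_def B_def algebra_simps)
  qed
  with split heavy light show ?thesis by linarith
qed

text \<open>
  Countably many exceptional sets cover the superlevel set. The bound for finite families does not
  depend on the family, so it passes to the increasing union of the exceptional sets.
\<close>

theorem superlevel_set_bound:
  "emeasure (weight_measure w) {x. ennreal (v x) < maximal_op g x}
    \<le> ennreal (weak_type_const p r CARD('n) * Ku ^ 3 * Kw\<^sup>2 * Atot)"
proof -
  define F where "F N = {i \<in> stopping. to_nat i < N}" for N
  have F: "finite (F N)" "F N \<subseteq> stopping" for N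
  proof -
    have "F N \<subseteq> to_nat -` {..<N}" by (auto simp only: F_def vimage_def lessThan_def)
    then show "finite (F N)" by (rule finite_subset) (auto intro: finite_vimageI inj_to_nat)
    show "F N \<subseteq> stopping" by (auto simp only: F_def)
  qed
  define X where "X N = (\<Union>i\<in>F N. exceptional i)" for N
  have X: "X N \<in> sets (weight_measure w)" for N
    unfolding X_def using F(1) exceptional_sets by (intro sets.finite_UN) auto
  have "incseq X"
    unfolding X_def F_def by (intro incseq_SucI UN_mono) auto
  have "(\<Union>i\<in>stopping. exceptional i) \<subseteq> (\<Union>N. X N)"
  proof (rule UN_least)
    fix i assume "i \<in> stopping"
    then have "i \<in> F (Suc (to_nat i))" by (simp add: F_def)
    then show "exceptional i \<subseteq> (\<Union>N. X N)" unfolding X_def by blast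
  qed
  with superlevel_set_subset have "{x. ennreal (v x) < maximal_op g x} \<subseteq> (\<Union>N. X N)" by blast
  then have "emeasure (weight_measure w) {x. ennreal (v x) < maximal_op g x}
      \<le> emeasure (weight_measure w) (\<Union>N. X N)"
    using X by (intro emeasure_mono) auto
  also have "\<dots> = (SUP N. emeasure (weight_measure w) (X N))"
    using X \<open>incseq X\<close> by (intro SUP_emeasure_incseq[symmetric]) auto
  also have "\<dots> \<le> ennreal (weak_type_const p r CARD('n) * Ku ^ 3 * Kw\<^sup>2 * Atot)"
  proof (rule SUP_least)
    fix N
    have "bounded (X N)" unfolding X_def by (intro bounded_UN F(1) ballI bounded_exceptional)
    then have "emeasure (weight_measure w) (X N) = ennreal (W (X N))"
      using X by (intro emeasure_eq_measure2 weight_fmeasurable[OF w]) auto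
    also have "\<dots> \<le> ennreal (weak_type_const p r CARD('n) * Ku ^ 3 * Kw\<^sup>2 * Atot)"
      unfolding X_def by (intro ennreal_leI W_finite_stopping F)
    finally show "emeasure (weight_measure w) (X N) \<le> ennreal (weak_type_const p r CARD('n) * Ku ^ 3 * Kw\<^sup>2 * Atot)" .
  qed
  finally show ?thesis .
qed

end

section \<open>Superadditivity and the layer cake formula\<close>

lemma powr_ge_tangent:
  fixes t c p :: real
  assumes "1 \<le> p" "0 \<le> t" "0 \<le> c"
  shows "c powr p + p * c powr (p - 1) * (t - c) \<le> t powr p"
proof -
  have mvt: "\<exists>\<xi>. a < \<xi> \<and> \<xi> < b \<and> b powr p - a powr p = (b - a) * (p * \<xi> powr (p - 1))"
    if "0 < a" "a < b" for a b :: real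
    using that by (intro MVT2) (auto intro!: derivative_eq_intros)
  consider "c = 0" | "t = 0" "0 < c" | "t = c" | "0 < c" "c < t" | "0 < t" "t < c"
    using assms by linarith
  then show ?thesis
  proof cases
    case 2
    have "c powr (p - 1) * c = c powr p" using 2 by (simp add: powr_diff)
    moreover have "c powr p \<le> p * c powr p" using mult_right_mono[OF assms(1), of "c powr p"] by simp
    ultimately show ?thesis using 2 by (simp add: mult.assoc)
  next
    case 4
    then obtain \<xi> where \<xi>: "c < \<xi>" "t powr p - c powr p = (t - c) * (p * \<xi> powr (p - 1))" using mvt by blast
    have "(t - c) * (p * c powr (p - 1)) \<le> (t - c) * (p * \<xi> powr (p - 1))"
      using \<xi>(1) 4 assms by (intro mult_left_mono powr_mono2) auto
    then show ?thesis using \<xi>(2) by (simp add: mult_ac)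
  next
    case 5
    then obtain \<xi> where \<xi>: "t < \<xi>" "\<xi> < c" "c powr p - t powr p = (c - t) * (p * \<xi> powr (p - 1))" using mvt by blast
    have "(c - t) * (p * \<xi> powr (p - 1)) \<le> (c - t) * (p * c powr (p - 1))"
      using \<xi>(1,2) 5 assms by (intro mult_left_mono powr_mono2) auto
    then have "c powr p - t powr p \<le> (c - t) * (p * c powr (p - 1))" using \<xi>(3) by simp
    moreover have "(c - t) * (p * c powr (p - 1)) = - (p * c powr (p - 1) * (t - c))" by (simp add: algebra_simps)
    ultimately show ?thesis by linarith
  qed (use assms in auto)
qed

text \<open>
  Minkowski's integral inequality for the \<open>l\<^sup>p\<close> norm \<open>H\<close> of the family. Bound \<open>t\<^sup>p\<close> below by its
  tangent at \<open>c i\<close>, evaluate at \<open>t = h i x / H x\<close> and multiply by \<open>H x\<close>. In the integral the linear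
  terms cancel, because \<open>c i\<close> is the quotient of the integrals of \<open>h i\<close> and \<open>H\<close>.
\<close>

lemma sum_powr_integral_le:
  fixes h :: "'i \<Rightarrow> 'a \<Rightarrow> real" and H :: "'a \<Rightarrow> real"
  assumes F: "finite F" and p: "1 \<le> p"
    and meas: "\<And>i. i \<in> F \<Longrightarrow> h i \<in> borel_measurable M"
    and nonneg: "\<And>i x. 0 \<le> h i x" "\<And>x. 0 \<le> H x"
    and eq: "\<And>x. H x powr p = (\<Sum>i\<in>F. h i x powr p)"
    and int: "integrable M H"
  shows "(\<Sum>i\<in>F. (\<integral>x. h i x \<partial>M) powr p) \<le> (\<integral>x. H x \<partial>M) powr p"
proof -
  define I where "I = (\<integral>x. H x \<partial>M)"
  define c where "c i = (\<integral>x. h i x \<partial>M) / I" for i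
  have h_le: "h i x \<le> H x" if "i \<in> F" for i x
  proof (rule ccontr)
    assume "\<not> ?thesis"
    then have "H x powr p < h i x powr p" using p nonneg by (intro powr_less_mono2) auto
    also have "\<dots> \<le> H x powr p" unfolding eq using F that by (intro member_le_sum) auto
    finally show False by simp
  qed
  have h_int: "integrable M (h i)" if "i \<in> F" for i
    using int meas[OF that] by (rule Bochner_Integration.integrable_bound) (use h_le[OF that] nonneg in auto)
  have X_nonneg: "0 \<le> (\<integral>x. h i x \<partial>M)" for i using nonneg by (intro Bochner_Integration.integral_nonneg) auto
  have X_le: "(\<integral>x. h i x \<partial>M) \<le> I" if "i \<in> F" for i
    unfolding I_def using h_int[OF that] int h_le[OF that] by (intro Bochner_Integration.integral_mono) auto
  have "0 \<le> I" unfolding I_def using nonneg by (intro Bochner_Integration.integral_nonneg) auto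
  show ?thesis
  proof (cases "I = 0")
    case True
    then have "(\<integral>x. h i x \<partial>M) = 0" if "i \<in> F" for i
      using X_le[OF that] X_nonneg[of i] by simp
    then show ?thesis by simp
  next
    case False
    with \<open>0 \<le> I\<close> have I: "0 < I" by simp
    have c: "0 \<le> c i" for i using X_nonneg I by (simp add: c_def)
    have pointwise: "(\<Sum>i\<in>F. H x * c i powr p + p * c i powr (p - 1) * (h i x - c i * H x)) \<le> H x" for x
    proof (cases "H x = 0")
      case True
      then have "h i x = 0" if "i \<in> F" for i using h_le[OF that, of x] nonneg(1)[of i x] by simp
      with True show ?thesis by simp
    next
      case False
      with nonneg(2)[of x] have Hx: "0 < H x" by simp
      have "(\<Sum>i\<in>F. H x * c i powr p + p * c i powr (p - 1) * (h i x - c i * H x))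
          = H x * (\<Sum>i\<in>F. c i powr p + p * c i powr (p - 1) * (h i x / H x - c i))"
        unfolding sum_distrib_left using Hx by (intro sum.cong) (auto simp: field_simps)
      also have "\<dots> \<le> H x * (\<Sum>i\<in>F. (h i x / H x) powr p)"
        using Hx p c nonneg by (intro mult_left_mono sum_mono powr_ge_tangent) auto
      also have "(\<Sum>i\<in>F. (h i x / H x) powr p) = (\<Sum>i\<in>F. h i x powr p) / H x powr p"
        using nonneg Hx by (simp add: powr_divide sum_divide_distrib)
      also have "\<dots> = 1" using Hx by (simp add: eq[symmetric])
      finally show ?thesis by simp
    qed
    have "(\<integral>x. (\<Sum>i\<in>F. H x * c i powr p + p * c i powr (p - 1) * (h i x - c i * H x)) \<partial>M)
        = (\<Sum>i\<in>F. I * c i powr p + p * c i powr (p - 1) * ((\<integral>x. h i x \<partial>M) - c i * I))"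
      using int h_int by (subst Bochner_Integration.integral_sum) (auto simp: I_def)
    also have "\<dots> = I * (\<Sum>i\<in>F. c i powr p)"
      using I by (simp add: c_def sum_distrib_left)
    finally have "I * (\<Sum>i\<in>F. c i powr p)
        = (\<integral>x. (\<Sum>i\<in>F. H x * c i powr p + p * c i powr (p - 1) * (h i x - c i * H x)) \<partial>M)" by simp
    also have "\<dots> \<le> I"
      unfolding I_def using pointwise int h_int
      by (intro Bochner_Integration.integral_mono Bochner_Integration.integrable_sum
          Bochner_Integration.integrable_add) auto
    finally have "I * (\<Sum>i\<in>F. c i powr p) \<le> I" .
    then have "(\<Sum>i\<in>F. c i powr p) \<le> 1" using I by simp
    moreover have "(\<Sum>i\<in>F. c i powr p) = (\<Sum>i\<in>F. (\<integral>x. h i x \<partial>M) powr p) / I powr p"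
      using X_nonneg I by (simp add: c_def powr_divide sum_divide_distrib)
    ultimately show ?thesis using I unfolding I_def[symmetric] by (simp add: divide_le_eq)
  qed
qed

lemma sigma_finite_lebesgue: "sigma_finite_measure (lebesgue :: (real ^ 'n) measure)"
proof
  show "\<exists>A. countable A \<and> A \<subseteq> sets lebesgue \<and> \<Union> A = space lebesgue \<and>
      (\<forall>a\<in>A. emeasure (lebesgue :: (real ^ 'n) measure) a \<noteq> \<infinity>)"
  proof (intro exI[of _ "range (\<lambda>k. cball 0 (real k))"] conjI)
    show "\<Union> (range (\<lambda>k. cball 0 (real k))) = space (lebesgue :: (real ^ 'n) measure)"
      using real_arch_simple by (auto simp: set_eq_iff) 
    show "\<forall>a\<in>range (\<lambda>k. cball 0 (real k)). emeasure (lebesgue :: (real ^ 'n) measure) a \<noteq> \<infinity>"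
      using fmeasurableD2[OF lmeasurable_cball] by auto
  qed auto
qed

lemma emeasure_lborel_greaterThan: "emeasure lborel {a <..} = \<infinity>" for a :: real
proof -
  have "of_nat k \<le> emeasure lborel {a <..}" for k
  proof -
    have "of_nat k = emeasure lborel {a <..< a + real k}" by (simp add: ennreal_of_nat_eq_real_of_nat)
    also have "\<dots> \<le> emeasure lborel {a <..}" by (rule emeasure_mono) auto
    finally show ?thesis .
  qed
  then have "(SUP k. of_nat k) \<le> emeasure lborel {a <..}" by (rule SUP_least)
  then show ?thesis by (simp add: ennreal_SUP_of_nat_eq_top top_unique)
qed

lemma nn_integral_layer_cake:
  assumes "sigma_finite_measure M"
    and [measurable]: "f \<in> borel_measurable M" "h \<in> borel_measurable M"
  shows "(\<integral>\<^sup>+x. f x * h x \<partial>M)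
    = (\<integral>\<^sup>+y\<in>{0<..}. (\<integral>\<^sup>+x. f x * indicator {x. ennreal y < h x} x \<partial>M) \<partial>lborel)"
proof -
  interpret pair_sigma_finite M "lborel :: real measure"
    using assms(1) by (simp add: pair_sigma_finite_def lborel.sigma_finite_measure_axioms)
  have layer: "(\<integral>\<^sup>+y. indicator {0<..} y * (if ennreal y < t then 1 else 0) \<partial>lborel) = t" for t
  proof (cases "t = \<infinity>")
    case True
    then have "(\<integral>\<^sup>+y. indicator {0<..} y * (if ennreal y < t then 1 else 0) \<partial>lborel)
        = (\<integral>\<^sup>+y. indicator {0<..} y \<partial>(lborel :: real measure))"
      by (intro nn_integral_cong) auto
    also have "\<dots> = \<infinity>" by (simp add: emeasure_lborel_greaterThan)
    finally show ?thesis using True by simp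
  next
    case False
    then obtain s where s: "t = ennreal s" "0 \<le> s" by (cases t) auto
    then have "(\<integral>\<^sup>+y. indicator {0<..} y * (if ennreal y < t then 1 else 0) \<partial>lborel)
        = (\<integral>\<^sup>+y. indicator {0<..<s} y \<partial>(lborel :: real measure))"
      by (intro nn_integral_cong) (auto simp: ennreal_less_iff indicator_def)
    also have "\<dots> = t" using s by simp
    finally show ?thesis .
  qed
  have "(\<integral>\<^sup>+x. f x * h x \<partial>M)
      = (\<integral>\<^sup>+x. (\<integral>\<^sup>+y. f x * (indicator {0<..} y * (if ennreal y < h x then 1 else 0)) \<partial>lborel) \<partial>M)"
    by (simp add: nn_integral_cmult layer)
  also have "\<dots> = (\<integral>\<^sup>+y. (\<integral>\<^sup>+x. f x * (indicator {0<..} y * (if ennreal y < h x then 1 else 0)) \<partial>M) \<partial>lborel)"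
    by (rule Fubini'[symmetric]) measurable
  also have "\<dots> = (\<integral>\<^sup>+y. (\<integral>\<^sup>+x. f x * indicator {x. ennreal y < h x} x \<partial>M) * indicator {0<..} y \<partial>lborel)"
    by (intro nn_integral_cong) (auto simp: indicator_def intro!: nn_integral_cong)
  finally show ?thesis .
qed

text \<open>
  The integral of \<open>min a ((c / s)\<^sup>e)\<close> with \<open>e = q / (q - 1)\<close>, split at the point \<open>s0\<close> where the two bounds
  coincide; the two parts contribute \<open>1\<close> and \<open>q - 1\<close> times \<open>c a\<^bsup>1/q\<^esup>\<close>.
\<close>

lemma nn_integral_truncated_tail_le:
  fixes a c q :: real
  assumes q: "1 < q" and a: "0 < a" and c: "0 < c"
    and \<phi>: "\<And>s. \<phi> s \<le> ennreal a" "\<And>s. 0 < s \<Longrightarrow> \<phi> s \<le> ennreal ((c / s) powr (q / (q - 1)))"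
  shows "(\<integral>\<^sup>+s\<in>{0<..}. \<phi> s \<partial>lborel) \<le> ennreal (q * c * a powr (1 / q))"
proof -
  define e where "e = q / (q - 1)"
  define s0 where "s0 = c * a powr (- 1 / e)"
  have e: "1 < e" "1 / (e - 1) = q - 1" "1 / e = 1 - 1 / q"
    using q by (auto simp: e_def field_simps)
  have s0: "0 < s0" using a c by (simp add: s0_def)
  \<comment> \<open>The maximum with \<open>s0\<close> only makes the integrand regular on the whole line.\<close>
  have tail: "(\<integral>\<^sup>+s. ennreal ((c / max s0 s) powr e) * indicator {s0..} s \<partial>lborel)
      = ennreal (0 - (- (c powr e * s0 powr (1 - e) / (e - 1))))"
  proof (rule nn_integral_FTC_atLeast[where F = "\<lambda>s. - (c powr e * s powr (1 - e) / (e - 1))"])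
    show "((\<lambda>s. - (c powr e * s powr (1 - e) / (e - 1))) has_real_derivative (c / max s0 s) powr e) (at s)"
      if "s0 \<le> s" for s
    proof -
      have "0 < s" using that s0 by linarith
      then have "((\<lambda>s. - (c powr e * s powr (1 - e) / (e - 1))) has_real_derivative
          - (c powr e * ((1 - e) * s powr (1 - e - 1)) / (e - 1))) (at s)"
        using e(1) by (auto intro!: derivative_eq_intros)
      moreover have "- (c powr e * ((1 - e) * s powr (1 - e - 1)) / (e - 1)) = (c / s) powr e"
        using e(1) c \<open>0 < s\<close> by (simp add: powr_divide powr_minus_divide field_simps)
      ultimately show ?thesis using that by (simp add: max_absorb2)
    qed
    show "((\<lambda>s. - (c powr e * s powr (1 - e) / (e - 1))) \<longlongrightarrow> 0) at_top"
    proof -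
      have "((\<lambda>s. s powr (1 - e)) \<longlongrightarrow> 0) at_top"
        using e(1) by (intro tendsto_neg_powr filterlim_ident) auto
      from tendsto_mult_right[OF this, of "- (c powr e / (e - 1))"] show ?thesis by (simp add: mult.commute)
    qed
  qed auto
  have "(\<integral>\<^sup>+s\<in>{0<..}. \<phi> s \<partial>lborel)
      \<le> (\<integral>\<^sup>+s. ennreal a * indicator {0<..<s0} s + ennreal ((c / max s0 s) powr e) * indicator {s0..} s \<partial>lborel)"
    using \<phi> by (intro nn_integral_mono) (auto simp: indicator_def e_def max_def)
  also have "\<dots> = ennreal (a * s0) + ennreal (c powr e * s0 powr (1 - e) / (e - 1))"
    using s0 a by (subst nn_integral_add) (auto simp: tail nn_integral_cmult ennreal_mult)
  also have "\<dots> = ennreal (a * s0 + c powr e * s0 powr (1 - e) / (e - 1))"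
    using s0 a e(1) by (intro ennreal_plus[symmetric]) auto
  also have "a * s0 = c * a powr (1 / q)"
  proof -
    have "a powr (1 / q) = a powr (1 + - 1 / e)" using e(3) by simp
    also have "\<dots> = a * a powr (- 1 / e)" using a by (subst powr_add) simp
    finally show ?thesis by (simp add: s0_def)
  qed
  also have "c powr e * s0 powr (1 - e) / (e - 1) = (q - 1) * (c * a powr (1 / q))"
  proof -
    have "s0 powr (1 - e) = c powr (1 - e) * a powr ((- 1 / e) * (1 - e))"
      using c by (simp add: s0_def powr_mult powr_powr)
    also have "(- 1 / e) * (1 - e) = 1 - 1 / e" using e(1) by (simp add: field_simps)
    also have "1 - 1 / e = 1 / q" using e(3) by simp
    finally have "c powr e * s0 powr (1 - e) = (c powr e * c powr (1 - e)) * a powr (1 / q)" by simp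
    also have "c powr e * c powr (1 - e) = c" using c by (simp flip: powr_add)
    finally have "c powr e * s0 powr (1 - e) / (e - 1) = 1 / (e - 1) * (c * a powr (1 / q))" by simp
    then show ?thesis by (simp only: e(2))
  qed
  also have "c * a powr (1 / q) + (q - 1) * (c * a powr (1 / q)) = q * c * a powr (1 / q)"
    by (simp add: algebra_simps)
  finally show ?thesis .
qed

section \<open>From the restricted constant to the restricted inequality\<close>

lemma ennreal_powr_ennreal: "0 \<le> x \<Longrightarrow> ennreal_powr (ennreal x) a = ennreal (x powr a)"
  by (simp add: ennreal_powr_def)

lemma ennreal_powr_mono:
  assumes "s \<le> t" "0 \<le> a" shows "ennreal_powr s a \<le> ennreal_powr t a"
proof (cases "t = \<infinity>")
  case False
  then have "t < \<infinity>" by (simp add: less_top)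
  with assms show ?thesis
    by (auto simp: ennreal_powr_def less_top enn2real_mono intro!: ennreal_leI powr_mono2)
qed (simp add: ennreal_powr_def)

lemma le_powr_if_mult_ennreal_powr_le:
  assumes "ennreal y * ennreal_powr d (1 / e) \<le> ennreal c" "0 < y" "0 < e" "0 \<le> c"
  shows "d \<le> ennreal ((c / y) powr e)"
proof (cases d)
  case (real x)
  then have "y * x powr (1 / e) \<le> c"
    using assms by (simp add: ennreal_powr_ennreal ennreal_mult[symmetric])
  then have "(x powr (1 / e)) powr e \<le> (c / y) powr e"
    using assms real by (intro powr_mono2) (auto simp: field_simps)
  then show ?thesis using real assms by (simp add: powr_powr ennreal_leI)
next
  case top
  with assms show ?thesis by (simp add: ennreal_powr_def ennreal_mult_top top_unique)
qed

text \<open>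
  The volume of \<open>S\<close> is the \<open>w\<close>-integral of \<open>1 / w\<close> over \<open>S\<close>. In the layer cake formula the layers are
  bounded both by \<open>w(S)\<close> and by the weak type estimate for \<open>1 / w\<close>. For \<open>q = 1\<close> the weak norm is an
  essential supremum and the bound is immediate.
\<close>

lemma volume_le_if_weak_norm_le:
  fixes w :: "real ^ 'n \<Rightarrow> real"
  assumes w: "weight w" and q: "1 \<le> q" and c: "0 < c"
    and norm: "lorentz_weak_norm (conj_exponent q) w (\<lambda>x. indicator Q x * ennreal (inverse (w x))) \<le> ennreal c"
    and Q: "Q \<in> sets lebesgue" "bounded Q" and S: "S \<in> sets lebesgue" "S \<subseteq> Q"
  shows "measure lebesgue S \<le> q * c * measure (weight_measure w) S powr (1 / q)"
proof -
  note [measurable] = weight_measurable[OF w] Q(1) S(1)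
  have bS: "bounded S" using Q(2) S(2) by (rule bounded_subset)
  define a where "a = measure (weight_measure w) S"
  have a_eq: "emeasure (weight_measure w) S = ennreal a"
    unfolding a_def by (rule emeasure_eq_measure2[OF weight_fmeasurable[OF w bS S(1)]])
  have S_vol: "emeasure lebesgue S = ennreal (measure lebesgue S)"
    using S(1) bS by (intro emeasure_eq_measure2 bounded_set_imp_lmeasurable)
  have "0 \<le> a" by (simp add: a_def)
  then consider "a = 0" | "0 < a" "q = 1" | "0 < a" "1 < q"
    using q \<open>0 \<le> a\<close> by linarith
  then have "emeasure lebesgue S \<le> ennreal (q * c * a powr (1 / q))"
  proof cases
    case 1
    then show ?thesis using a_eq emeasure_weight_eq_0_iff[OF w S(1)] by simp
  next
    case 2
    have "esssup (weight_measure w) (\<lambda>x. indicator Q x * ennreal (inverse (w x))) \<le> ennreal c"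
      using norm 2 by (simp add: lorentz_weak_norm_def conj_exponent_def)
    then have "AE x in weight_measure w. indicator Q x * ennreal (inverse (w x)) \<le> ennreal c"
      using esssup_AE[of "\<lambda>x. indicator Q x * ennreal (inverse (w x))" "weight_measure w"]
      by (auto elim!: eventually_mono intro: order_trans)
    then have "AE x in lebesgue. indicator Q x * ennreal (inverse (w x)) \<le> ennreal c"
      unfolding weight_measure_def by (subst (asm) AE_density) (simp_all add: weight_pos[OF w])
    then have "AE x in lebesgue. indicator S x \<le> ennreal c * (ennreal (w x) * indicator S x)"
    proof (rule AE_mp, intro AE_I2 impI)
      fix x assume x: "indicator Q x * ennreal (inverse (w x)) \<le> ennreal c"
      show "indicator S x \<le> ennreal c * (ennreal (w x) * indicator S x)"
      proof (cases "x \<in> S")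
        case True
        then have "inverse (w x) \<le> c" using x S(2) c by (auto simp: ennreal_le_iff)
        then have "1 \<le> c * w x" using weight_pos[OF w, of x] by (simp add: field_simps)
        with True c weight_pos[OF w, of x] show ?thesis
          by (simp add: ennreal_mult[symmetric] less_imp_le)
      qed simp
    qed
    then have "(\<integral>\<^sup>+x. indicator S x \<partial>lebesgue) \<le> (\<integral>\<^sup>+x. ennreal c * (ennreal (w x) * indicator S x) \<partial>lebesgue)"
      by (rule nn_integral_mono_AE)
    also have "\<dots> = ennreal c * ennreal a"
      by (subst nn_integral_cmult) (simp_all add: emeasure_weight[OF w S(1), symmetric] a_eq)
    finally show ?thesis using 2 c by (simp add: ennreal_mult[symmetric])
  next
    case 3
    define e where "e = q / (q - 1)"
    have e: "0 < e" using 3 by (simp add: e_def)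
    define \<phi> where "\<phi> y = (\<integral>\<^sup>+x. (ennreal (w x) * indicator S x)
      * indicator {x. ennreal y < ennreal (inverse (w x))} x \<partial>lebesgue)" for y
    have "emeasure lebesgue S = (\<integral>\<^sup>+x. (ennreal (w x) * indicator S x) * ennreal (inverse (w x)) \<partial>lebesgue)"
    proof -
      have "ennreal (w x) * indicator S x * ennreal (inverse (w x)) = indicator S x" for x
        using weight_pos[OF w, of x]
        by (auto simp: indicator_def ennreal_mult[symmetric])
      then show ?thesis by simp
    qed
    also have "\<dots> = (\<integral>\<^sup>+y\<in>{0<..}. \<phi> y \<partial>lborel)"
      unfolding \<phi>_def by (rule nn_integral_layer_cake[OF sigma_finite_lebesgue]) measurable
    also have "\<dots> \<le> ennreal (q * c * a powr (1 / q))"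
    proof (rule nn_integral_truncated_tail_le[OF 3(2,1) c])
      show "\<phi> y \<le> ennreal a" for y
        unfolding \<phi>_def a_eq[symmetric] emeasure_weight[OF w S(1)]
        by (intro nn_integral_mono) (auto simp: indicator_def)
      show "\<phi> y \<le> ennreal ((c / y) powr (q / (q - 1)))" if y: "0 < y" for y
      proof -
        let ?B = "{x. ennreal y < indicator Q x * ennreal (inverse (w x))}"
        have "?B = {x \<in> space lebesgue. ennreal y < indicator Q x * ennreal (inverse (w x))}" by simp
        also have "\<dots> \<in> sets lebesgue" by measurable
        finally have B: "?B \<in> sets lebesgue" .
        have "\<phi> y \<le> (\<integral>\<^sup>+x\<in>?B. ennreal (w x) \<partial>lebesgue)"
          unfolding \<phi>_def using S(2) by (intro nn_integral_mono) (auto simp: indicator_def)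
        also have "\<dots> = distribution_fun w (\<lambda>x. indicator Q x * ennreal (inverse (w x))) y"
          unfolding distribution_fun_def by (rule emeasure_weight[OF w B, symmetric])
        also have "\<dots> \<le> ennreal ((c / y) powr e)"
        proof (rule le_powr_if_mult_ennreal_powr_le[OF _ y e])
          have "ennreal y * ennreal_powr (distribution_fun w (\<lambda>x. indicator Q x * ennreal (inverse (w x))) y) (1 / e)
              \<le> lorentz_weak_norm (conj_exponent q) w (\<lambda>x. indicator Q x * ennreal (inverse (w x)))"
            using 3 y by (simp add: lorentz_weak_norm_def conj_exponent_def e_def) (rule SUP_upper, simp)
          with norm show "ennreal y * ennreal_powr (distribution_fun w (\<lambda>x. indicator Q x * ennreal (inverse (w x))) y) (1 / e)
              \<le> ennreal c" by (rule order_trans[rotated])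
        qed (use c in simp)
        finally show ?thesis by (simp add: e_def)
      qed
    qed
    finally show ?thesis .
  qed
  then show ?thesis
    using S_vol q c by (simp add: a_def)
qed

text \<open>
  Applied to the \<open>A\<^sub>q\<^sup>R\<close> constant, which is first replaced by larger, hence positive, numbers.
\<close>

lemma le_mult_if_all_greater:
  fixes x k c :: real
  assumes "0 \<le> k" "\<And>c'. c < c' \<Longrightarrow> x \<le> k * c'"
  shows "x \<le> k * c"
proof -
  have "((\<lambda>c'. k * c') \<longlongrightarrow> k * c) (at_right c)"
    by (intro tendsto_intros)
  moreover have "\<forall>\<^sub>F c' in at_right c. x \<le> k * c'"
    using assms(2) eventually_at_right_less[of c] by (auto elim: eventually_mono)
  ultimately show ?thesis by (rule tendsto_lowerbound) simp
qed

lemma le_ennreal_if_mult_divide_le: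
  assumes "ennreal s * N / ennreal V \<le> ennreal c" "0 < s" "0 < V" "0 \<le> c"
  shows "N \<le> ennreal (c * V / s)"
proof (cases N)
  case (real x)
  then have "s * x / V \<le> c"
    using assms by (simp add: ennreal_mult[symmetric] divide_ennreal)
  then have "x \<le> c * V / s" using assms by (simp add: field_simps)
  then show ?thesis using real by (simp add: ennreal_leI)
next
  case top
  with assms show ?thesis by (simp add: ennreal_mult_top ennreal_top_divide top_unique)
qed

text \<open>
  The constant bounds the weak norm of \<open>1 / w\<close> over the closure of each half-open cube, and the
  closure adds only a null set.
\<close>

lemma ApR_imp_restricted_Ap:
  fixes w :: "real ^ 'n \<Rightarrow> real"
  assumes w: "w \<in> ApR q" and q: "1 \<le> q"
  shows "restricted_Ap q ((q * enn2real (ApR_const q w)) powr q) w"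
  unfolding restricted_Ap_def
proof (intro allI impI)
  fix a :: "real ^ 'n" and h :: real and S :: "(real ^ 'n) set"
  assume h: "0 < h" and S: "S \<in> sets lebesgue" "S \<subseteq> halfopen_cube a h"
  define c where "c = enn2real (ApR_const q w)"
  have weight: "weight w" and c: "ApR_const q w = ennreal c" "0 \<le> c"
    using w by (auto simp: ApR_def c_def less_top)
  let ?H = "halfopen_cube a h" and ?Q = "cbox a (a + (\<chi> i. h))" and ?w = "measure (weight_measure w)"
  define V where "V = measure lebesgue ?H"
  have V: "0 < V" using h by (simp add: V_def measure_halfopen_cube)
  have Q_eq: "?Q = ?H \<union> (?Q - ?H)" using halfopen_cube_between(2)[of a h] by blast
  have null: "?Q - ?H \<in> null_sets lebesgue" by (rule null_set_cbox_diff_halfopen)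
  have null_w: "?Q - ?H \<in> null_sets (weight_measure w)"
    using null emeasure_weight_eq_0_iff[OF weight, of "?Q - ?H"] by (simp add: null_sets_def)
  have "emeasure lebesgue ?Q = emeasure lebesgue ?H"
    by (subst Q_eq) (rule emeasure_Un_null_set[OF _ null], simp)
  then have Q_vol: "emeasure lebesgue ?Q = ennreal V"
    unfolding V_def by (simp add: emeasure_eq_measure2)
  have "emeasure (weight_measure w) ?Q = emeasure (weight_measure w) ?H"
    by (subst Q_eq) (rule emeasure_Un_null_set[OF _ null_w], simp)
  then have Q_w: "emeasure (weight_measure w) ?Q = ennreal (?w ?H)"
    by (simp add: emeasure_eq_measure2[OF weight_fmeasurable[OF weight]])
  have "emeasure lebesgue ?H \<noteq> 0" using V by (simp add: V_def emeasure_eq_measure2)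
  then have wH: "0 < ?w ?H"
    using emeasure_weight_eq_0_iff[OF weight, of ?H]
    by (simp add: emeasure_eq_measure2[OF weight_fmeasurable[OF weight]] zero_less_measure_iff)
  define N where "N = lorentz_weak_norm (conj_exponent q) w (\<lambda>x. indicator ?Q x * ennreal (inverse (w x)))"
  have "?Q \<in> cubes" using h by (auto simp: cubes_def)
  then have "ennreal_powr (emeasure (weight_measure w) ?Q) (1 / q) * N / emeasure lebesgue ?Q \<le> ennreal c"
    unfolding c(1)[symmetric] ApR_const_def N_def by (rule SUP_upper)
  then have "ennreal (?w ?H powr (1 / q)) * N / ennreal V \<le> ennreal c"
    by (simp only: Q_w Q_vol ennreal_powr_ennreal[OF measure_nonneg])
  then have N_le: "N \<le> ennreal (c * V / ?w ?H powr (1 / q))"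
    by (rule le_ennreal_if_mult_divide_le) (use wH V c in auto)
  have "measure lebesgue S \<le> (q * V / ?w ?H powr (1 / q) * ?w S powr (1 / q)) * c"
  proof (rule le_mult_if_all_greater)
    fix c' assume c': "c < c'"
    have "N \<le> ennreal (c' * V / ?w ?H powr (1 / q))"
      by (rule order_trans[OF N_le]) (use c' V wH in \<open>auto intro!: ennreal_leI divide_right_mono mult_right_mono\<close>)
    then have "measure lebesgue S \<le> q * (c' * V / ?w ?H powr (1 / q)) * ?w S powr (1 / q)"
      unfolding N_def using c' c V wH S halfopen_cube_between(2)[of a h]
      by (intro volume_le_if_weak_norm_le[OF weight q, where Q = ?Q]) auto
    then show "measure lebesgue S \<le> (q * V / ?w ?H powr (1 / q) * ?w S powr (1 / q)) * c'"
      by (simp add: mult_ac)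
  qed (use q V in auto)
  also have "\<dots> = (q * c) * V * (?w S / ?w ?H) powr (1 / q)"
    by (simp add: powr_divide mult_ac)
  finally have "measure lebesgue S powr q \<le> ((q * c) * V * (?w S / ?w ?H) powr (1 / q)) powr q"
    using q by (intro powr_mono2) auto
  also have "\<dots> = (q * c) powr q * V powr q * (?w S / ?w ?H)"
    using q c V by (simp add: powr_mult powr_powr)
  finally show "?w ?H * measure lebesgue S powr q \<le> (q * enn2real (ApR_const q w)) powr q * measure lebesgue ?H powr q * ?w S"
    using wH unfolding c_def[symmetric] V_def[symmetric] by (simp add: field_simps)
qed

section \<open>The Lorentz norm on dyadic cubes\<close>

text \<open>
  The integrand of the Lorentz norm of \<open>g\<close> restricted to \<open>B\<close>, extended by zero to negative levels.
\<close>

definition level_root :: "(real ^ 'n \<Rightarrow> real) \<Rightarrow> (real ^ 'n \<Rightarrow> ennreal) \<Rightarrow> real \<Rightarrow> (real ^ 'n) set \<Rightarrow> real \<Rightarrow> real" where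
  "level_root u g p B y = indicator {0<..} y * measure (weight_measure u) (B \<inter> {x. ennreal y < g x}) powr (1 / p)"

lemma level_root_nonneg: "0 \<le> level_root u g p B y"
  by (simp add: level_root_def)

lemma superlevel_sets_lebesgue:
  fixes g :: "real ^ 'n \<Rightarrow> ennreal"
  assumes "g \<in> borel_measurable lebesgue" shows "{x. t < g x} \<in> sets lebesgue"
proof -
  note [measurable] = assms
  have "{x \<in> space lebesgue. t < g x} \<in> sets lebesgue" by measurable
  then show ?thesis by simp
qed

lemma level_root_measurable:
  assumes u: "weight u" and g: "g \<in> borel_measurable lebesgue" and B: "B \<in> sets lebesgue" "bounded B"
  shows "level_root u g p B \<in> borel_measurable lborel"
proof -
  have "mono (\<lambda>y. - measure (weight_measure u) (B \<inter> {x. ennreal y < g x}))"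
  proof (rule monoI)
    fix y z :: real assume "y \<le> z"
    then have "B \<inter> {x. ennreal z < g x} \<subseteq> B \<inter> {x. ennreal y < g x}"
      by (auto intro: le_less_trans[OF ennreal_leI])
    then show "- measure (weight_measure u) (B \<inter> {x. ennreal y < g x})
        \<le> - measure (weight_measure u) (B \<inter> {x. ennreal z < g x})"
      using B superlevel_sets_lebesgue[OF g] by (simp, intro measure_weight_mono[OF u]) (auto intro: bounded_Int)
  qed
  then have "(\<lambda>y. - measure (weight_measure u) (B \<inter> {x. ennreal y < g x})) \<in> borel_measurable borel"
    by (rule borel_measurable_mono)
  then have [measurable]: "(\<lambda>y. - (- measure (weight_measure u) (B \<inter> {x. ennreal y < g x}))) \<in> borel_measurable borel"
    by (rule borel_measurable_uminus)
  then show ?thesis unfolding level_root_def by simp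
qed

lemma level_root_le:
  assumes u: "weight u" and g: "g \<in> borel_measurable lebesgue" and B: "B \<in> sets lebesgue" "bounded B"
    and p: "1 \<le> p"
  shows "ennreal (level_root u g p B y)
    \<le> ennreal_powr (distribution_fun u g y) (1 / p) * indicator {0<..} y"
proof (cases "0 < y")
  case True
  let ?S = "B \<inter> {x. ennreal y < g x}"
  have "ennreal (level_root u g p B y) = ennreal_powr (ennreal (measure (weight_measure u) ?S)) (1 / p)"
    using True by (simp add: level_root_def ennreal_powr_ennreal)
  also have "ennreal (measure (weight_measure u) ?S) = emeasure (weight_measure u) ?S"
    using B superlevel_sets_lebesgue[OF g]
    by (intro emeasure_eq_measure2[symmetric] weight_fmeasurable[OF u]) (auto intro: bounded_Int)
  also have "ennreal_powr (emeasure (weight_measure u) ?S) (1 / p) \<le> ennreal_powr (distribution_fun u g y) (1 / p)"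
    unfolding distribution_fun_def using superlevel_sets_lebesgue[OF g] p
    by (intro ennreal_powr_mono emeasure_mono) auto
  finally show ?thesis using True by simp
qed (simp add: level_root_def)

lemma level_root_integrable:
  assumes u: "weight u" and g: "g \<in> borel_measurable lebesgue" and B: "B \<in> sets lebesgue" "bounded B"
    and p: "1 \<le> p"
    and J: "(\<integral>\<^sup>+y\<in>{0<..}. ennreal_powr (distribution_fun u g y) (1 / p) \<partial>lborel) = ennreal J" "0 \<le> J"
  shows "integrable lborel (level_root u g p B)" "(\<integral>y. level_root u g p B y \<partial>lborel) \<le> J"
    "(\<integral>\<^sup>+y. ennreal (level_root u g p B y) \<partial>lborel) = ennreal (\<integral>y. level_root u g p B y \<partial>lborel)"
proof -
  have le: "(\<integral>\<^sup>+y. ennreal (level_root u g p B y) \<partial>lborel) \<le> ennreal J"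
    unfolding J(1)[symmetric] using level_root_le[OF assms(1-5)] by (intro nn_integral_mono)
  show int: "integrable lborel (level_root u g p B)"
    using level_root_measurable[OF assms(1-4), of p] le
    by (intro integrableI_nonneg) (auto simp: level_root_nonneg intro: le_less_trans)
  show eq: "(\<integral>\<^sup>+y. ennreal (level_root u g p B y) \<partial>lborel) = ennreal (\<integral>y. level_root u g p B y \<partial>lborel)"
    by (intro nn_integral_eq_integral[OF int]) (simp add: level_root_nonneg)
  show "(\<integral>y. level_root u g p B y \<partial>lborel) \<le> J"
    using le J(2) unfolding eq by (simp add: ennreal_le_iff)
qed

lemma sum_level_root_integral_le:
  assumes u: "weight u" and g: "g \<in> borel_measurable lebesgue" and p: "1 \<le> p"
    and J: "(\<integral>\<^sup>+y\<in>{0<..}. ennreal_powr (distribution_fun u g y) (1 / p) \<partial>lborel) = ennreal J" "0 \<le> J"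
    and F: "finite F" "disjoint_family_on dcube F"
  shows "(\<Sum>i\<in>F. (\<integral>y. level_root u g p (dcube i) y \<partial>lborel) powr p) \<le> J powr p"
proof -
  let ?B = "\<Union>i\<in>F. dcube i"
  have B: "?B \<in> sets lebesgue" "bounded ?B"
    using F(1) by (intro sets.finite_UN bounded_UN; simp)+
  have "(\<Sum>i\<in>F. (\<integral>y. level_root u g p (dcube i) y \<partial>lborel) powr p) \<le> (\<integral>y. level_root u g p ?B y \<partial>lborel) powr p"
  proof (rule sum_powr_integral_le[OF F(1) p])
    show "level_root u g p (dcube i) \<in> borel_measurable lborel" for i
      by (rule level_root_measurable[OF u g]) simp_all
    show "integrable lborel (level_root u g p ?B)"
      by (rule level_root_integrable(1)[OF u g B p J])
    show "level_root u g p ?B y powr p = (\<Sum>i\<in>F. level_root u g p (dcube i) y powr p)" for y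
    proof (cases "0 < y")
      case True
      let ?S = "\<lambda>i. dcube i \<inter> {x. ennreal y < g x}"
      have "measure (weight_measure u) (?B \<inter> {x. ennreal y < g x}) = measure (weight_measure u) (\<Union>i\<in>F. ?S i)"
        by (rule arg_cong[of _ _ "measure _"]) blast
      also have "\<dots> = (\<Sum>i\<in>F. measure (weight_measure u) (?S i))"
      proof (rule measure_finite_Union[OF F(1)])
        show "?S ` F \<subseteq> sets (weight_measure u)" using superlevel_sets_lebesgue[OF g] by auto
        show "disjoint_family_on ?S F" using F(2) unfolding disjoint_family_on_def by blast
        show "emeasure (weight_measure u) (?S i) \<noteq> \<infinity>" for i
          using emeasure_weight_finite[OF u, of "?S i"] by (simp add: bounded_Int)
      qed
      finally show ?thesis using True p by (simp add: level_root_def powr_powr sum_nonneg)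
    qed (simp add: level_root_def)
  qed (rule level_root_nonneg)+
  also have "\<dots> \<le> J powr p"
    using level_root_integrable(2)[OF u g B p J] p level_root_nonneg
    by (intro powr_mono2 Bochner_Integration.integral_nonneg) auto
  finally show ?thesis .
qed

lemma restricted_Ap_root:
  assumes Ap: "restricted_Ap p K u" and u: "weight u" and p: "1 \<le> p"
    and S: "S \<in> sets lebesgue" "S \<subseteq> dcube i"
  shows "measure lebesgue S \<le> K powr (1 / p) * measure lebesgue (dcube i)
    * measure (weight_measure u) (dcube i) powr (- 1 / p) * measure (weight_measure u) S powr (1 / p)"
proof -
  let ?U = "measure (weight_measure u)" and ?V = "measure lebesgue (dcube i)"
  have K: "1 \<le> K" by (rule restricted_Ap_ge_1[OF Ap u])
  have UQ: "0 < ?U (dcube i)" by (rule measure_weight_dcube_pos[OF u])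
  define t where "t = 1 / ?U (dcube i)"
  have t: "0 < t" "t powr (1 / p) = ?U (dcube i) powr (- 1 / p)"
    using UQ by (simp_all add: t_def powr_divide powr_minus_divide)
  have "measure lebesgue S powr p \<le> K * ?V powr p * t * ?U S"
    using restricted_Ap_dcube[OF Ap S] UQ by (simp add: t_def field_simps)
  then have "(measure lebesgue S powr p) powr (1 / p) \<le> (K * ?V powr p * t * ?U S) powr (1 / p)"
    using p by (intro powr_mono2) auto
  also have "\<dots> = K powr (1 / p) * ?V * t powr (1 / p) * ?U S powr (1 / p)"
    using p K t(1) by (simp add: powr_mult powr_powr)
  finally show ?thesis using p by (simp add: powr_powr t(2))
qed

text \<open>
  Layer cake formula for \<open>g\<close> and the restricted inequality on each layer: the restricted estimate
  for characteristic functions upgrades to the Lorentz space because its norm is an integral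
  over layers.
\<close>

lemma mass_le_level_root:
  fixes i :: "int \<times> (int ^ 'n)"
  assumes Ap: "restricted_Ap p K u" and u: "weight u" and p: "1 \<le> p"
    and g: "g \<in> borel_measurable lebesgue"
    and J: "(\<integral>\<^sup>+y\<in>{0<..}. ennreal_powr (distribution_fun u g y) (1 / p) \<partial>lborel) = ennreal J" "0 \<le> J"
  defines "X \<equiv> K powr (1 / p) * measure lebesgue (dcube i)
    * measure (weight_measure u) (dcube i) powr (- 1 / p) * (\<integral>y. level_root u g p (dcube i) y \<partial>lborel)"
  shows "emeasure (density lebesgue g) (dcube i) \<le> ennreal X" "0 \<le> X"
proof -
  note [measurable] = g
  let ?V = "measure lebesgue (dcube i)"
  define k where "k = K powr (1 / p) * ?V * measure (weight_measure u) (dcube i) powr (- 1 / p)"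
  have I: "0 \<le> (\<integral>y. level_root u g p (dcube i) y \<partial>lborel)"
    using level_root_nonneg by (intro Bochner_Integration.integral_nonneg) auto
  have k: "0 \<le> k" using restricted_Ap_ge_1[OF Ap u] by (simp add: k_def)
  have "emeasure (density lebesgue g) (dcube i) = (\<integral>\<^sup>+x. indicator (dcube i) x * g x \<partial>lebesgue)"
    by (subst emeasure_density) (auto simp: mult.commute)
  also have "\<dots> = (\<integral>\<^sup>+y\<in>{0<..}. (\<integral>\<^sup>+x. indicator (dcube i) x * indicator {x. ennreal y < g x} x \<partial>lebesgue) \<partial>lborel)"
    by (rule nn_integral_layer_cake[OF sigma_finite_lebesgue]) measurable
  also have "\<dots> \<le> (\<integral>\<^sup>+y. ennreal k * ennreal (level_root u g p (dcube i) y) \<partial>lborel)"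
  proof (rule nn_integral_mono)
    fix y :: real
    let ?S = "dcube i \<inter> {x. ennreal y < g x}"
    have S: "?S \<in> sets lebesgue" using superlevel_sets_lebesgue[OF g] by auto
    have "(\<integral>\<^sup>+x. indicator (dcube i) x * indicator {x. ennreal y < g x} x \<partial>lebesgue) = emeasure lebesgue ?S"
      using S by (simp add: indicator_inter_arith[symmetric])
    also have "\<dots> = ennreal (measure lebesgue ?S)"
      using S by (intro emeasure_eq_measure2 bounded_set_imp_lmeasurable) (auto intro: bounded_Int)
    also have "\<dots> \<le> ennreal (k * measure (weight_measure u) ?S powr (1 / p))"
      unfolding k_def by (intro ennreal_leI restricted_Ap_root[OF Ap u p S]) simp
    finally show "(\<integral>\<^sup>+x. indicator (dcube i) x * indicator {x. ennreal y < g x} x \<partial>lebesgue) * indicator {0<..} y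
        \<le> ennreal k * ennreal (level_root u g p (dcube i) y)"
      using k by (cases "0 < y") (auto simp: level_root_def ennreal_mult[symmetric])
  qed
  also have "\<dots> = ennreal k * (\<integral>\<^sup>+y. ennreal (level_root u g p (dcube i) y) \<partial>lborel)"
    using level_root_measurable[OF u g, of "dcube i" p] by (intro nn_integral_cmult) simp
  also have "\<dots> = ennreal (k * (\<integral>y. level_root u g p (dcube i) y \<partial>lborel))"
    using k I level_root_integrable(3)[OF u g dcube_sets bounded_dcube p J, of i]
    by (simp add: ennreal_mult)
  finally show "emeasure (density lebesgue g) (dcube i) \<le> ennreal X" by (simp add: X_def k_def)
  show "0 \<le> X"
    using k I unfolding X_def k_def[symmetric] by (rule mult_nonneg_nonneg)
qed

lemma avg_powr_le_level_root:
  assumes Ap: "restricted_Ap p K u" and u: "weight u" and p: "1 \<le> p"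
    and g: "g \<in> borel_measurable lebesgue"
    and J: "(\<integral>\<^sup>+y\<in>{0<..}. ennreal_powr (distribution_fun u g y) (1 / p) \<partial>lborel) = ennreal J" "0 \<le> J"
  shows "(measure (density lebesgue g) (dcube i) / measure lebesgue (dcube i)) powr p
      * measure (weight_measure u) (dcube i)
    \<le> K * (\<integral>y. level_root u g p (dcube i) y \<partial>lborel) powr p"
proof -
  let ?V = "measure lebesgue (dcube i)" and ?U = "measure (weight_measure u) (dcube i)"
    and ?I = "\<integral>y. level_root u g p (dcube i) y \<partial>lborel"
  have K: "1 \<le> K" by (rule restricted_Ap_ge_1[OF Ap u])
  have UQ: "0 < ?U" by (rule measure_weight_dcube_pos[OF u])
  have V: "0 < ?V" by (rule measure_dcube_pos)
  have I: "0 \<le> ?I" using level_root_nonneg by (intro Bochner_Integration.integral_nonneg) auto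
  have "measure (density lebesgue g) (dcube i) \<le> K powr (1 / p) * ?V * ?U powr (- 1 / p) * ?I"
    using mass_le_level_root[OF assms, of i] unfolding measure_def
    by (metis enn2real_ennreal enn2real_mono ennreal_less_top)
  then have "measure (density lebesgue g) (dcube i) / ?V \<le> K powr (1 / p) * ?U powr (- 1 / p) * ?I"
    using V by (simp add: divide_le_eq mult_ac)
  then have "(measure (density lebesgue g) (dcube i) / ?V) powr p \<le> (K powr (1 / p) * ?U powr (- 1 / p) * ?I) powr p"
    using p by (intro powr_mono2) auto
  also have "\<dots> = K * (1 / ?U) * ?I powr p"
  proof -
    define t where "t = ?U powr (- 1 / p)"
    have "t powr p = ?U powr (- 1 / p * p)" by (simp only: t_def powr_powr)
    also have "- 1 / p * p = - 1" using p by simp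
    finally have t: "0 < t" "t powr p = 1 / ?U"
      using UQ by (simp_all add: t_def powr_minus_divide)
    have "(K powr (1 / p) * t * ?I) powr p = K * t powr p * ?I powr p"
      using p K t(1) I by (simp add: powr_mult powr_powr)
    then show ?thesis by (simp only: t_def[symmetric] t(2))
  qed
  finally show ?thesis using UQ by (simp add: field_simps)
qed

lemma weight_cmult:
  assumes "weight w" "0 < c" shows "weight (\<lambda>x. c * w x)"
  using assms by (auto simp: weight_def)

lemma emeasure_weight_cmult:
  assumes "weight w" "0 < c"
  shows "emeasure (weight_measure (\<lambda>x. c * w x)) S = ennreal c * emeasure (weight_measure w) S"
proof (cases "S \<in> sets lebesgue")
  case True
  have "emeasure (weight_measure (\<lambda>x. c * w x)) S = (\<integral>\<^sup>+x. ennreal c * (ennreal (w x) * indicator S x) \<partial>lebesgue)"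
    unfolding emeasure_weight[OF weight_cmult[OF assms] True]
    using assms by (intro nn_integral_cong) (simp add: ennreal_mult' mult.assoc)
  also have "\<dots> = ennreal c * emeasure (weight_measure w) S"
    unfolding emeasure_weight[OF assms(1) True] using True weight_measurable[OF assms(1)]
    by (intro nn_integral_cmult) auto
  finally show ?thesis .
qed (simp add: emeasure_notin_sets)

lemma restricted_Ap_cmult:
  assumes "restricted_Ap q K w" "weight w" "0 < c"
  shows "restricted_Ap q K (\<lambda>x. c * w x)"
proof -
  have "measure (weight_measure (\<lambda>x. c * w x)) S = c * measure (weight_measure w) S" for S
    using assms(3) by (simp add: measure_def emeasure_weight_cmult[OF assms(2,3)] enn2real_mult)
  with assms show ?thesis by (simp add: restricted_Ap_def mult.assoc mult.left_commute[of _ c])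
qed

section \<open>The mixed weak type inequality\<close>

lemma less_divide_ennreal_iff:
  assumes "0 < v" "0 \<le> y"
  shows "ennreal y < m / ennreal v \<longleftrightarrow> ennreal (y * v) < m"
proof (cases m)
  case (real x)
  then show ?thesis using assms by (simp add: divide_ennreal ennreal_less_iff field_simps)
next
  case top
  then show ?thesis using assms by (simp add: ennreal_top_divide)
qed

lemma mult_ennreal_powr_root_le:
  assumes "ennreal (y powr p) * d \<le> ennreal B" "0 < y" "1 \<le> p" "0 \<le> B"
  shows "ennreal y * ennreal_powr d (1 / p) \<le> ennreal (B powr (1 / p))"
proof (cases d)
  case (real x)
  then have "y powr p * x \<le> B" using assms by (simp add: ennreal_mult[symmetric])
  then have "(y powr p * x) powr (1 / p) \<le> B powr (1 / p)"
    using assms real by (intro powr_mono2) auto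
  then have "y * x powr (1 / p) \<le> B powr (1 / p)"
    using assms real by (simp add: powr_mult powr_powr)
  then show ?thesis
    using real assms by (simp add: ennreal_powr_ennreal ennreal_mult[symmetric] ennreal_leI)
next
  case top
  with assms show ?thesis by (simp add: ennreal_mult_top top_unique)
qed

lemma weak_type_const_pos: "0 < weak_type_const p r d"
  by (simp add: weak_type_const_def add_nonneg_pos)

text \<open>
  The level \<open>y\<close> is absorbed by replacing \<open>v\<close> with \<open>y v\<close>, which multiplies the weight \<open>u v\<^sup>p\<close> by
  \<open>y\<^sup>p\<close> and keeps its restricted inequality.
\<close>

theorem maximal_level_bound:
  fixes u v :: "real ^ 'n \<Rightarrow> real" and g :: "real ^ 'n \<Rightarrow> ennreal"
  assumes p: "1 \<le> p" and r: "1 \<le> r"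
    and u: "weight u" and v: "weight v" and weight_uv: "weight (\<lambda>x. u x * v x powr p)"
    and Ap_u: "restricted_Ap p Ku u" and Ap_w: "restricted_Ap r Kw (\<lambda>x. u x * v x powr p)"
    and g: "g \<in> borel_measurable lebesgue"
    and J: "(\<integral>\<^sup>+t\<in>{0<..}. ennreal_powr (distribution_fun u g t) (1 / p) \<partial>lborel) = ennreal J" "0 \<le> J"
    and y: "0 < y"
  shows "ennreal y * ennreal_powr (distribution_fun (\<lambda>x. u x * v x powr p)
      (\<lambda>x. maximal_op g x / ennreal (v x)) y) (1 / p)
    \<le> ennreal ((weak_type_const p r CARD('n) * Ku ^ 3 * Kw\<^sup>2) powr (1 / p) * J)"
proof -
  let ?w = "\<lambda>x. u x * v x powr p"
  have yp: "0 < y powr p" using y by simp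
  interpret mixed_weights p r Ku Kw u "\<lambda>x. y * v x" "\<lambda>x. y powr p * ?w x" g
    "\<lambda>i. (\<integral>t. level_root u g p (dcube i) t \<partial>lborel) powr p" "J powr p"
  proof
    show "(\<lambda>x. y * v x) \<in> borel_measurable lebesgue" using weight_measurable[OF v] by simp
    show "emeasure (density lebesgue g) (dcube i) < \<infinity>" for i
      using mass_le_level_root(1)[OF Ap_u u p g J, of i] by (rule le_less_trans) simp
  qed (use p r y in \<open>auto intro: u weight_cmult[OF weight_uv yp] Ap_u restricted_Ap_cmult[OF Ap_w weight_uv yp] g
      avg_powr_le_level_root[OF Ap_u u p g J] sum_level_root_integral_le[OF u g p J]
      simp: weight_pos[OF v] powr_mult less_imp_le\<close>)
  have "{x. maximal_op g x / ennreal (v x) > ennreal y} = {x. ennreal (y * v x) < maximal_op g x}"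
    using y by (simp add: less_divide_ennreal_iff weight_pos[OF v])
  then have "ennreal (y powr p) * distribution_fun ?w (\<lambda>x. maximal_op g x / ennreal (v x)) y
      = emeasure (weight_measure (\<lambda>x. y powr p * ?w x)) {x. ennreal (y * v x) < maximal_op g x}"
    using emeasure_weight_cmult[OF weight_uv yp, of "{x. ennreal (y * v x) < maximal_op g x}"]
    by (simp add: distribution_fun_def)
  also have "\<dots> \<le> ennreal (weak_type_const p r CARD('n) * Ku ^ 3 * Kw\<^sup>2 * J powr p)"
    by (rule superlevel_set_bound)
  finally have "ennreal y * ennreal_powr (distribution_fun ?w (\<lambda>x. maximal_op g x / ennreal (v x)) y) (1 / p)
      \<le> ennreal ((weak_type_const p r CARD('n) * Ku ^ 3 * Kw\<^sup>2 * J powr p) powr (1 / p))"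
    using y p Ku_ge_1 weak_type_const_pos[of p r "CARD('n)"]
    by (intro mult_ennreal_powr_root_le) auto
  also have "(weak_type_const p r CARD('n) * Ku ^ 3 * Kw\<^sup>2 * J powr p) powr (1 / p)
      = (weak_type_const p r CARD('n) * Ku ^ 3 * Kw\<^sup>2) powr (1 / p) * (J powr p) powr (1 / p)"
    by (rule powr_mult)
  also have "(J powr p) powr (1 / p) = J" using p J(2) by (simp add: powr_powr)
  finally show ?thesis .
qed

text \<open>
  The constant is an explicit product of positive powers of \<open>a\<close> and \<open>b\<close>, which gives strict
  monotonicity. At the actual arguments it only has to be positive, and there \<open>a\<close> and \<open>b\<close> cannot
  vanish since a restricted inequality has a constant of at least \<open>1\<close>.
\<close>

theorem lemma3p10:
  fixes p r :: real
  assumes "1 \<le> p" and "1 \<le> r"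
  shows "\<exists>E :: real \<Rightarrow> real \<Rightarrow> real.
    (\<forall>a\<ge>1. \<forall>b\<ge>1. 0 < E a b) \<and>
    (\<forall>b\<ge>1. strict_mono_on {1..} (\<lambda>a. E a b)) \<and>
    (\<forall>a\<ge>1. strict_mono_on {1..} (\<lambda>b. E a b)) \<and>
    (\<forall>(u :: real ^ 'n \<Rightarrow> real) v f :: real ^ 'n \<Rightarrow> real.
       weight u \<longrightarrow> weight v \<longrightarrow> u \<in> ApR p \<longrightarrow> (\<lambda>x. u x * v x powr p) \<in> ApR r \<longrightarrow>
       f \<in> borel_measurable lebesgue \<longrightarrow>
       lorentz_weak_norm (ereal p) (\<lambda>x. u x * v x powr p)
           (\<lambda>x. maximal_op (\<lambda>z. ennreal \<bar>f z\<bar>) x / ennreal (v x))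
         \<le> ennreal (E (enn2real (ApR_const p u))
                      (enn2real (ApR_const r (\<lambda>x. u x * v x powr p))))
            * lorentz_1_norm p u (\<lambda>z. ennreal \<bar>f z\<bar>))"
proof -
  define D where "D = weak_type_const p r CARD('n)"
  have D: "0 < D" by (simp add: D_def weak_type_const_pos)
  define E where "E a b = (D * ((p * a) powr p) ^ 3 * ((r * b) powr r)\<^sup>2) powr (1 / p) / p" for a b
  have E_eq: "E a b = D powr (1 / p) / p * (p * a) ^ 3 * (r * b) powr (2 * r / p)" if "0 < a" "0 < b" for a b
  proof -
    have "((p * a) powr p) ^ 3 = ((p * a) ^ 3) powr p" by (simp only: power3_eq_cube powr_mult)
    then have "(((p * a) powr p) ^ 3) powr (1 / p) = (p * a) ^ 3"
      using that assms by (simp add: powr_powr)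
    moreover have "(((r * b) powr r)\<^sup>2) powr (1 / p) = (r * b) powr (2 * r / p)"
    proof -
      have "((r * b) powr r)\<^sup>2 = (r * b) powr (2 * r)"
        by (simp only: power2_eq_square powr_add[symmetric] mult_2)
      then show ?thesis by (simp add: powr_powr)
    qed
    ultimately show ?thesis by (simp only: E_def powr_mult) simp
  qed
  have k: "0 < D powr (1 / p) / p" using D assms by simp
  have E_pos: "0 < E a b" if "0 < a" "0 < b" for a b
    using that assms D by (simp add: E_eq)
  have mono1: "strict_mono_on {1..} (\<lambda>a. E a b)" if "1 \<le> b" for b
  proof (rule strict_mono_onI)
    fix a a' :: real assume a: "a \<in> {1..}" "a' \<in> {1..}" "a < a'"
    have "(p * a) ^ 3 < (p * a') ^ 3"
      using a assms by (intro power_strict_mono mult_strict_left_mono) auto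
    moreover have "0 < (r * b) powr (2 * r / p)" using that assms by simp
    ultimately have "D powr (1 / p) / p * (p * a) ^ 3 * (r * b) powr (2 * r / p)
        < D powr (1 / p) / p * (p * a') ^ 3 * (r * b) powr (2 * r / p)"
      using k by (intro mult_strict_right_mono mult_strict_left_mono)
    then show "E a b < E a' b"
      using a that by (subst (1 2) E_eq) auto
  qed
  have mono2: "strict_mono_on {1..} (\<lambda>b. E a b)" if "1 \<le> a" for a
  proof (rule strict_mono_onI)
    fix b b' :: real assume b: "b \<in> {1..}" "b' \<in> {1..}" "b < b'"
    have "(r * b) powr (2 * r / p) < (r * b') powr (2 * r / p)"
      using b assms by (intro powr_less_mono2 mult_strict_left_mono) auto
    moreover have "0 < D powr (1 / p) / p * (p * a) ^ 3"
      using that assms by (intro mult_pos_pos[OF k] zero_less_power) auto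
    ultimately have "D powr (1 / p) / p * (p * a) ^ 3 * (r * b) powr (2 * r / p)
        < D powr (1 / p) / p * (p * a) ^ 3 * (r * b') powr (2 * r / p)"
      by (intro mult_strict_left_mono)
    then show "E a b < E a b'"
      using b that by (subst (1 2) E_eq) auto
  qed
  have bound: "lorentz_weak_norm (ereal p) (\<lambda>x. u x * v x powr p)
      (\<lambda>x. maximal_op (\<lambda>z. ennreal \<bar>f z\<bar>) x / ennreal (v x))
    \<le> ennreal (E (enn2real (ApR_const p u)) (enn2real (ApR_const r (\<lambda>x. u x * v x powr p))))
      * lorentz_1_norm p u (\<lambda>z. ennreal \<bar>f z\<bar>)"
    if u: "weight u" and v: "weight v" and Ap: "u \<in> ApR p" "(\<lambda>x. u x * v x powr p) \<in> ApR r"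
      and f: "f \<in> borel_measurable lebesgue" for u v f :: "real ^ 'n \<Rightarrow> real"
  proof -
    let ?w = "\<lambda>x. u x * v x powr p" and ?g = "\<lambda>z. ennreal \<bar>f z\<bar>"
    define a where "a = enn2real (ApR_const p u)"
    define b where "b = enn2real (ApR_const r ?w)"
    have w: "weight ?w" using Ap(2) by (simp add: ApR_def)
    have Ku: "restricted_Ap p ((p * a) powr p) u" and Kw: "restricted_Ap r ((r * b) powr r) ?w"
      unfolding a_def b_def using Ap assms by (auto intro: ApR_imp_restricted_Ap)
    have "a \<noteq> 0" using restricted_Ap_ge_1[OF Ku u] by auto
    then have a: "0 < a" by (simp add: a_def order_less_le)
    have "b \<noteq> 0" using restricted_Ap_ge_1[OF Kw w] by auto
    then have b: "0 < b" by (simp add: b_def order_less_le)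
    have Eab: "0 < E a b" using a b by (rule E_pos)
    have g: "?g \<in> borel_measurable lebesgue" using f by simp
    let ?J = "\<integral>\<^sup>+t\<in>{0<..}. ennreal_powr (distribution_fun u ?g t) (1 / p) \<partial>lborel"
    have "lorentz_weak_norm (ereal p) ?w (\<lambda>x. maximal_op ?g x / ennreal (v x))
        \<le> ennreal (E a b) * lorentz_1_norm p u ?g"
    proof (cases "?J = \<infinity>")
      case True
      then have "lorentz_1_norm p u ?g = \<infinity>"
        using assms by (simp add: lorentz_1_norm_def ennreal_mult_top)
      then show ?thesis using Eab by (simp add: ennreal_mult_top)
    next
      case False
      then obtain J where J: "?J = ennreal J" "0 \<le> J" by (cases ?J) auto
      have "lorentz_weak_norm (ereal p) ?w (\<lambda>x. maximal_op ?g x / ennreal (v x))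
          = (SUP y\<in>{0<..}. ennreal y * ennreal_powr (distribution_fun ?w
              (\<lambda>x. maximal_op ?g x / ennreal (v x)) y) (1 / p))"
        by (simp add: lorentz_weak_norm_def)
      also have "\<dots> \<le> ennreal ((D * ((p * a) powr p) ^ 3 * ((r * b) powr r)\<^sup>2) powr (1 / p) * J)"
        unfolding D_def
        by (intro SUP_least maximal_level_bound[OF assms u v w Ku Kw g J]) simp
      also have "(D * ((p * a) powr p) ^ 3 * ((r * b) powr r)\<^sup>2) powr (1 / p) * J = E a b * (p * J)"
        using assms by (simp add: E_def)
      also have "ennreal (E a b * (p * J)) = ennreal (E a b) * lorentz_1_norm p u ?g"
        using Eab assms J by (simp add: lorentz_1_norm_def ennreal_mult)
      finally show ?thesis .
    qed
    then show ?thesis by (simp only: a_def b_def)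
  qed
  show ?thesis
    by (intro exI[of _ E] conjI allI impI) (simp_all add: E_pos mono1 mono2 bound)
qed

end
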